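(* Let $a>0$, $\sigma>1$, $\nu>0$, and let $u^0\in Z^{-1}_{a,\sigma}(\mathbb R^3)$ be a divergence-free vector field such that $\|u^0\|_{\mathcal{X}^{-1}(\mathbb R^3)}<\nu$. Then there exists a unique global solution $u\in\mathcal C(\mathbb R^+,Z^{-1}_{a,\sigma}(\mathbb R^3))\cap L^1(\mathbb R^+,Z^1_{a,\sigma}(\mathbb R^3))$ of (NSE) with initial data $u^0$.
   Context: (NSE) denotes the 3D incompressible Navier–Stokes system $\partial_t u-\nu\Delta u+u\cdot\nabla u=-\nabla p$, $\operatorname{div}u=0$ on $\mathbb R^+\times\mathbb R^3$, $u(0,x)=u^0(x)$, with viscosity $\nu>0$. The Fourier transform is $\hat f(\xi)=\int_{\mathbb R^3}e^{-ix\cdot\xi}f(x)\,dx$. For $a>0$, $\sigma>1$, $\rho\in\mathbb R$, the Lei–Lin–Gevrey space $Z^{\rho}_{a,\sigma}(\mathbb R^3)$ is the set of $f\in\mathcal S'(\mathbb R^3)$ with $\|f\|_{Z^{\rho}_{a,\sigma}}=\int_{\mathbb R^3}|\xi|^{\rho}e^{a|\xi|^{1/\sigma}}|\hat f(\xi)|\,d\xi<\infty$. The space $\mathcal X^{-1}(\mathbb R^3)$ is the set of distributions $f$ with $\|f\|_{\mathcal X^{-1}}=\int_{\mathbb R^3}\frac{|\hat f(\xi)|}{|\xi|}d\xi<\infty$. For vector fields, $|\hat f(\xi)|$ denotes the Euclidean norm of the vector $\hat f(\xi)$. *)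

theory Defs
  imports "HOL-Analysis.Analysis"
begin

text \<open>Everything is expressed on the Fourier side: a (tempered) vector field f on R^3
  whose Fourier transform is a function is represented by fhat :: real^3 => complex^3,
  with the convention fhat(xi) = integral of exp(-i x.xi) f(x) dx.\<close>

type_synonym fvec = "real^3 \<Rightarrow> complex^3"

definition Z_norm :: "real \<Rightarrow> real \<Rightarrow> real \<Rightarrow> fvec \<Rightarrow> ennreal" where
  "Z_norm \<rho> a \<sigma> fh =
     (\<integral>\<^sup>+ \<xi>. ennreal (norm \<xi> powr \<rho> * exp (a * norm \<xi> powr (1 / \<sigma>)) * norm (fh \<xi>)) \<partial>lborel)"

definition in_Z :: "real \<Rightarrow> real \<Rightarrow> real \<Rightarrow> fvec \<Rightarrow> bool" where
  "in_Z \<rho> a \<sigma> fh \<longleftrightarrow> fh \<in> borel_measurable lborel \<and> Z_norm \<rho> a \<sigma> fh < \<infinity>"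

definition X_minus1_norm :: "fvec \<Rightarrow> ennreal" where
  "X_minus1_norm fh = (\<integral>\<^sup>+ \<xi>. ennreal (norm (fh \<xi>) / norm \<xi>) \<partial>lborel)"

definition div_free :: "fvec \<Rightarrow> bool" where
  "div_free fh \<longleftrightarrow> (AE \<xi> in lborel. (\<Sum>j\<in>UNIV. complex_of_real (\<xi> $ j) * fh \<xi> $ j) = 0)"

definition real_field :: "fvec \<Rightarrow> bool" where
  "real_field fh \<longleftrightarrow> (AE \<xi> in lborel. fh (- \<xi>) = (\<chi> k. cnj (fh \<xi> $ k)))"

definition leray :: "real^3 \<Rightarrow> complex^3 \<Rightarrow> complex^3" where
  "leray \<xi> v = v - (\<chi> k. (\<Sum>j\<in>UNIV. complex_of_real (\<xi> $ j) * v $ j)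
                        * complex_of_real (\<xi> $ k) / complex_of_real ((norm \<xi>)\<^sup>2))"

text \<open>Fourier transform of u.grad u = div(u tensor u) (for div-free u):
  its k-th component is i sum_j xi_j (2 pi)^-3 integral uhat_j(xi-eta) uhat_k(eta) d eta.\<close>
definition nonlin :: "fvec \<Rightarrow> real^3 \<Rightarrow> complex^3" where
  "nonlin uh \<xi> = (\<chi> k. \<i> * (\<Sum>j\<in>UNIV. complex_of_real (\<xi> $ j) *
        ((\<integral>\<eta>. uh (\<xi> - \<eta>) $ j * uh \<eta> $ k \<partial>lborel) / complex_of_real ((2 * pi) ^ 3))))"

text \<open>Mild (Duhamel) formulation of (NSE) on the Fourier side; the pressure is
  eliminated by the Leray projector.\<close>
definition duhamel_integrand :: "real \<Rightarrow> (real \<Rightarrow> fvec) \<Rightarrow> real \<Rightarrow> real^3 \<Rightarrow> real \<Rightarrow> complex^3" where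
  "duhamel_integrand \<nu> u t \<xi> s = exp (- \<nu> * (t - s) * (norm \<xi>)\<^sup>2) *\<^sub>R leray \<xi> (nonlin (u s) \<xi>)"

definition NSE_mild :: "real \<Rightarrow> fvec \<Rightarrow> (real \<Rightarrow> fvec) \<Rightarrow> bool" where
  "NSE_mild \<nu> u0 u \<longleftrightarrow>
     (\<forall>t\<ge>0. AE \<xi> in lborel.
        set_integrable lborel {0..t} (duhamel_integrand \<nu> u t \<xi>) \<and>
        u t \<xi> = exp (- \<nu> * t * (norm \<xi>)\<^sup>2) *\<^sub>R u0 \<xi>
                 - (LINT s:{0..t}|lborel. duhamel_integrand \<nu> u t \<xi> s))"

definition sol_class :: "real \<Rightarrow> real \<Rightarrow> (real \<Rightarrow> fvec) \<Rightarrow> bool" where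
  "sol_class a \<sigma> u \<longleftrightarrow>
     (\<lambda>p. if fst p \<ge> 0 then u (fst p) (snd p) else 0) \<in> borel_measurable (lborel \<Otimes>\<^sub>M lborel) \<and>
     (\<forall>t\<ge>0. in_Z (-1) a \<sigma> (u t) \<and> div_free (u t) \<and> real_field (u t)) \<and>
     (\<forall>t0\<ge>0. ((\<lambda>t. Z_norm (-1) a \<sigma> (\<lambda>\<xi>. u t \<xi> - u t0 \<xi>)) \<longlongrightarrow> 0) (at t0 within {0..})) \<and>
     (\<integral>\<^sup>+ t. indicator {0..} t * Z_norm 1 a \<sigma> (u t) \<partial>lborel) < \<infinity>"

end

theory Submission
  imports Defs
begin

text \<open>
  Put \<open>\<theta> = 1/\<sigma> < 1\<close>. The Gevrey weight \<open>exp (a |\<xi>|\<^sup>\<theta>)\<close> is replaced by the equivalent weight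
  \<open>W (\<xi>) = exp (a ((|\<xi>| + R)\<^sup>\<theta> - R\<^sup>\<theta>))\<close>. It is still submultiplicative, but it tends to \<open>1\<close> as \<open>R\<close> grows, so by
  dominated convergence the \<open>W\<close>-weighted norm of \<open>u0\<close> is below \<open>\<nu>\<close> for large \<open>R\<close>: the data become small in the
  Gevrey space itself, and one small-data iteration yields the global solution there.

  The iteration is controlled by a scalar majorant \<open>F (t, \<xi>)\<close> solving the Duhamel inequality with \<open>|u0|\<close>. If
  \<open>F (t, \<xi>) \<le> G (\<xi>)\<close> for all \<open>t\<close> and \<open>\<nu> |\<xi>|\<^sup>2 \<integral> F dt \<le> G\<close>, then Cauchy--Schwarz gives
  \<open>\<integral> \<integral> W (F * F) d\<xi> dt \<le> (\<integral> W G / |\<xi>| d\<xi>)\<^sup>2 / \<nu>\<close>, which closes the estimate; \<open>G\<close> also dominates the solution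
  uniformly in time, which gives continuity by dominated convergence.

  For uniqueness, let \<open>x\<close> and \<open>b\<close> be the \<open>L\<^sup>1\<close> norms in \<open>\<xi>\<close> of the difference and of the sum of the moduli of two
  solutions. The same estimates give \<open>\<integral> x\<^sup>2 \<le> c (\<integral> x b)\<^sup>2\<close> on every \<open>[0, t]\<close>, and \<open>b\<close> is square integrable in time,
  so \<open>x b\<close> vanishes successively on short intervals.
\<close>

section \<open>The bilinear term\<close>

text \<open>Only \<open>X_minus1_norm u0\<close> is assumed small; the Gevrey norm of
  \<open>u0\<close> may be arbitrarily large, so a small-data argument cannot start in that norm.
  This obstacle forces the change of weight. Both demands on \<open>G\<close> have one source, the
  kernel exp (-\<nu> t |\<xi>|^2): it is at most 1, and its integral over t \<ge> 0 is 1 / (\<nu>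
  |\<xi>|^2). Hence a single function of \<xi> controls the solution uniformly in time and, with two
  more powers of |\<xi>|, in L1 of time. The divergence puts a factor |\<xi>| in front of the
  convolution, which the weight 1 / |\<xi>| cancels exactly. The (2 pi)^3 of the Fourier convention
  makes the bilinear constant so small that crude componentwise estimates still reach the threshold
  \<nu>. An increasing scalar iteration with values in \<open>ennreal\<close> replaces a contraction
  in a Banach space: no completeness has to be proved, Tonelli and monotone limits come free, and
  the exceptional null set can be chosen independent of time. Uniqueness is claimed among all
  solutions of the class, which need not be small; smallness then has to come from short time
  intervals.\<close>

definition econv :: "(real^3 \<Rightarrow> ennreal) \<Rightarrow> (real^3 \<Rightarrow> ennreal) \<Rightarrow> real^3 \<Rightarrow> ennreal" where
  "econv f g \<xi> = (\<integral>\<^sup>+ \<eta>. f (\<xi> - \<eta>) * g \<eta> \<partial>lborel)"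

lemma leray_diff: "leray \<xi> v - leray \<xi> w = leray \<xi> (v - w)"
  by (simp add: leray_def vec_eq_iff algebra_simps sum_subtractf diff_divide_distrib sum_distrib_left sum_distrib_right)

lemma leray_0 [simp]: "leray \<xi> 0 = 0"
  by (simp add: leray_def vec_eq_iff)

lemma norm_dot_le:
  "norm (\<Sum>j\<in>UNIV. complex_of_real (\<xi> $ j) * v $ j) \<le> 3 * norm \<xi> * norm v"
  for \<xi> :: "real^3" and v :: "complex^3"
proof -
  have "norm (\<Sum>j\<in>UNIV. complex_of_real (\<xi> $ j) * v $ j) \<le> (\<Sum>j\<in>(UNIV::3 set). norm \<xi> * norm v)"
    by (intro sum_norm_le)
       (simp add: norm_mult mult_mono component_le_norm_cart Finite_Cartesian_Product.norm_nth_le)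
  then show ?thesis by simp
qed

text \<open>For \<xi> \<noteq> 0 this is an orthogonal projection of norm 1. The cruder 4 = 1 + 3
  follows from \<open>norm_dot_le\<close> without orthogonality and is affordable.\<close>

lemma norm_leray_le: "norm (leray \<xi> v) \<le> 4 * norm v"
proof -
  define c where "c = (\<Sum>j\<in>UNIV. complex_of_real (\<xi> $ j) * v $ j)"
  have "norm (\<chi> k. c * complex_of_real (\<xi> $ k) / complex_of_real ((norm \<xi>)\<^sup>2))
      \<le> norm ((norm c / (norm \<xi>)\<^sup>2) *\<^sub>R \<xi>)"
    by (rule norm_le_componentwise_cart) (simp add: norm_mult norm_divide norm_power abs_mult)
  also have "\<dots> = norm c * norm \<xi> / (norm \<xi>)\<^sup>2" by simp
  also have "\<dots> \<le> 3 * norm v"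
  \<comment> \<open>At \<xi> = 0 the left side is 0 by the convention on division by zero.\<close>
  proof (cases "\<xi> = 0")
    case False
    have "norm c * norm \<xi> \<le> (3 * norm \<xi> * norm v) * norm \<xi>"
      unfolding c_def by (intro mult_right_mono norm_dot_le) simp
    then show ?thesis using False by (simp add: divide_le_eq power2_eq_square mult_ac)
  qed simp
  finally have "norm (leray \<xi> v) \<le> norm v + 3 * norm v"
    unfolding leray_def c_def by (intro norm_triangle_le_diff) simp
  then show ?thesis by simp
qed

lemma dot_leray:
  assumes "\<xi> \<noteq> 0"
  shows "(\<Sum>j\<in>UNIV. complex_of_real (\<xi> $ j) * leray \<xi> v $ j) = 0"
proof -
  define c where "c = (\<Sum>j\<in>UNIV. complex_of_real (\<xi> $ j) * v $ j)"
  have n: "(\<Sum>j\<in>UNIV. complex_of_real (\<xi> $ j) * complex_of_real (\<xi> $ j)) = complex_of_real ((norm \<xi>)\<^sup>2)"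
    by (simp add: power2_norm_eq_inner inner_vec_def)
  have "(\<Sum>j\<in>UNIV. complex_of_real (\<xi> $ j) * leray \<xi> v $ j)
     = c - (\<Sum>j\<in>UNIV. complex_of_real (\<xi> $ j) * (c * complex_of_real (\<xi> $ j) / complex_of_real ((norm \<xi>)\<^sup>2)))"
    by (simp add: leray_def c_def right_diff_distrib sum_subtractf)
  also have "(\<Sum>j\<in>UNIV. complex_of_real (\<xi> $ j) * (c * complex_of_real (\<xi> $ j) / complex_of_real ((norm \<xi>)\<^sup>2)))
     = c * (\<Sum>j\<in>UNIV. complex_of_real (\<xi> $ j) * complex_of_real (\<xi> $ j)) / complex_of_real ((norm \<xi>)\<^sup>2)"
    by (simp add: sum_distrib_left sum_divide_distrib mult_ac)
  also have "\<dots> = c" unfolding n using assms by simp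
  finally show ?thesis by simp
qed

lemma nonlin_0 [simp]: "nonlin (\<lambda>_. 0) \<xi> = 0" "nonlin f 0 = 0"
  by (simp_all add: nonlin_def vec_eq_iff)

lemma two_pi_cube_ge: "216 \<le> (2 * pi) ^ 3"
proof -
  have "(6::real) ^ 3 \<le> (2 * pi) ^ 3" using pi_gt3 by (intro power_mono) auto
  then show ?thesis by simp
qed

text \<open>Two factors 3, one from the sum over \<open>j\<close> and one from bounding the
  Euclidean norm by the sum over the components \<open>k\<close>, turn 216 into 24.\<close>

lemma norm_nonlin_diff_le:
  assumes "\<And>j k. norm ((\<integral>\<eta>. f (\<xi> - \<eta>) $ j * f \<eta> $ k \<partial>lborel) - (\<integral>\<eta>. g (\<xi> - \<eta>) $ j * g \<eta> $ k \<partial>lborel)) \<le> c"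
  shows "norm (nonlin f \<xi> - nonlin g \<xi>) \<le> norm \<xi> * c / 24"
proof -
  have "c \<ge> 0" using order_trans[OF norm_ge_zero assms] .
  have comp: "norm ((nonlin f \<xi> - nonlin g \<xi>) $ k) \<le> norm \<xi> * c / 72" for k
  proof -
    let ?I = "\<lambda>f j. \<integral>\<eta>. f (\<xi> - \<eta>) $ j * f \<eta> $ k \<partial>lborel"
    have "(nonlin f \<xi> - nonlin g \<xi>) $ k
       = \<i> * (\<Sum>j\<in>UNIV. complex_of_real (\<xi> $ j) * ((?I f j - ?I g j) / complex_of_real ((2 * pi) ^ 3)))"
      by (simp add: nonlin_def diff_divide_distrib right_diff_distrib sum_subtractf)
    also have "norm \<dots> \<le> (\<Sum>j\<in>(UNIV::3 set). norm \<xi> * (c / 216))"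
      unfolding norm_mult norm_ii mult_1_left
    proof (rule sum_norm_le)
      fix j
      have "norm ((?I f j - ?I g j) / complex_of_real ((2 * pi) ^ 3)) \<le> c / 216"
        unfolding norm_divide norm_of_real using two_pi_cube_ge assms[of j k] \<open>c \<ge> 0\<close>
        by (intro frac_le) auto
      then show "norm (complex_of_real (\<xi> $ j) * ((?I f j - ?I g j) / complex_of_real ((2 * pi) ^ 3)))
         \<le> norm \<xi> * (c / 216)"
        unfolding norm_mult norm_of_real using component_le_norm_cart[of \<xi> j]
        by (intro mult_mono) auto
    qed
    finally show ?thesis by (simp add: mult.commute)
  qed
  have "norm (nonlin f \<xi> - nonlin g \<xi>) \<le> (\<Sum>k\<in>UNIV. norm ((nonlin f \<xi> - nonlin g \<xi>) $ k))"
    unfolding norm_vec_def by (rule L2_set_le_sum) simp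
  also have "\<dots> \<le> (\<Sum>k\<in>(UNIV::3 set). norm \<xi> * c / 72)"
    by (intro sum_mono comp)
  finally show ?thesis by (simp add: mult.commute)
qed

lemma vec_nth_borel_measurable [measurable (raw)]:
  fixes f :: "'a \<Rightarrow> 'b::euclidean_space ^ 'n"
  assumes [measurable]: "f \<in> borel_measurable M"
  shows "(\<lambda>x. f x $ i) \<in> borel_measurable M"
  by (rule borel_measurable_continuous_on[OF _ assms, where f="\<lambda>v. v $ i"]) (intro continuous_intros)

lemma integrable_conv_component:
  fixes f :: fvec
  assumes [measurable]: "f \<in> borel_measurable borel"
    and "econv (\<lambda>\<eta>. norm (f \<eta>)) (\<lambda>\<eta>. norm (f \<eta>)) \<xi> < \<infinity>"
  shows "integrable lborel (\<lambda>\<eta>. f (\<xi> - \<eta>) $ j * f \<eta> $ k)"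
proof (rule integrableI_bounded)
  have "(\<integral>\<^sup>+ \<eta>. ennreal (norm (f (\<xi> - \<eta>) $ j * f \<eta> $ k)) \<partial>lborel)
      \<le> econv (\<lambda>\<eta>. norm (f \<eta>)) (\<lambda>\<eta>. norm (f \<eta>)) \<xi>"
    unfolding econv_def
    by (intro nn_integral_mono)
       (auto simp: norm_mult ennreal_mult[symmetric] intro!: ennreal_leI mult_mono Finite_Cartesian_Product.norm_nth_le)
  with assms show "(\<integral>\<^sup>+ \<eta>. ennreal (norm (f (\<xi> - \<eta>) $ j * f \<eta> $ k)) \<partial>lborel) < \<infinity>"
    by (rule_tac le_less_trans) auto
qed measurable

text \<open>The constant is \<open>1/6 = 4 \<cdot> 9 / 216\<close>: a factor \<open>4\<close> for the Leray projector, \<open>9\<close> for the sums over the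
  components, and \<open>(2 \<pi>)\<^sup>3 \<ge> 216\<close>.\<close>

lemma norm_leray_nonlin_diff_le:
  fixes f g :: fvec
  assumes [measurable]: "f \<in> borel_measurable borel" "g \<in> borel_measurable borel"
    and f: "econv (\<lambda>\<eta>. norm (f \<eta>)) (\<lambda>\<eta>. norm (f \<eta>)) \<xi> < \<infinity>"
    and g: "econv (\<lambda>\<eta>. norm (g \<eta>)) (\<lambda>\<eta>. norm (g \<eta>)) \<xi> < \<infinity>"
  shows "ennreal (norm (leray \<xi> (nonlin f \<xi>) - leray \<xi> (nonlin g \<xi>)))
     \<le> ennreal (norm \<xi> / 6) * (econv (\<lambda>\<eta>. norm (f \<eta> - g \<eta>)) (\<lambda>\<eta>. norm (f \<eta>)) \<xi>
                             + econv (\<lambda>\<eta>. norm (g \<eta>)) (\<lambda>\<eta>. norm (f \<eta> - g \<eta>)) \<xi>)"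
    (is "_ \<le> _ * ?C")
\<comment> \<open>At \<xi> = 0 both nonlinearities vanish, and for \<xi> \<noteq> 0 an infinite
  \<open>?C\<close> makes the right side infinite. In the remaining case the bound is a real
  number.\<close>
proof (cases "\<xi> = 0 \<or> ?C = \<infinity>")
  case True
  then show ?thesis by (auto simp: ennreal_mult_top)
next
  case False
  then obtain c where c: "?C = ennreal c" "c \<ge> 0" by (cases ?C) auto
  have "norm ((\<integral>\<eta>. f (\<xi> - \<eta>) $ j * f \<eta> $ k \<partial>lborel) - (\<integral>\<eta>. g (\<xi> - \<eta>) $ j * g \<eta> $ k \<partial>lborel)) \<le> c" for j k
  proof -
    note int = integrable_conv_component[OF assms(1) f, of j k] integrable_conv_component[OF assms(2) g, of j k]
    have "ennreal (norm ((\<integral>\<eta>. f (\<xi> - \<eta>) $ j * f \<eta> $ k \<partial>lborel) - (\<integral>\<eta>. g (\<xi> - \<eta>) $ j * g \<eta> $ k \<partial>lborel)))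
        = ennreal (norm (\<integral>\<eta>. f (\<xi> - \<eta>) $ j * f \<eta> $ k - g (\<xi> - \<eta>) $ j * g \<eta> $ k \<partial>lborel))"
      using int by simp
    also have "\<dots> \<le> (\<integral>\<^sup>+ \<eta>. norm (f (\<xi> - \<eta>) $ j * f \<eta> $ k - g (\<xi> - \<eta>) $ j * g \<eta> $ k) \<partial>lborel)"
      using int by (intro integral_norm_bound_ennreal) auto
    also have "\<dots> \<le> (\<integral>\<^sup>+ \<eta>. ennreal (norm (f (\<xi> - \<eta>) - g (\<xi> - \<eta>))) * ennreal (norm (f \<eta>))
             + ennreal (norm (g (\<xi> - \<eta>))) * ennreal (norm (f \<eta> - g \<eta>)) \<partial>lborel)"
    proof (rule nn_integral_mono)
      fix \<eta>
      let ?x = "f (\<xi> - \<eta>)" and ?y = "g (\<xi> - \<eta>)"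
      \<comment> \<open>Polarisation: the difference of the products is (f - g) f + g (f - g), with
        one mixed factor from each function.\<close>
      have "norm (?x $ j * f \<eta> $ k - ?y $ j * g \<eta> $ k)
          = norm ((?x - ?y) $ j * f \<eta> $ k + ?y $ j * (f \<eta> - g \<eta>) $ k)"
        by (simp add: algebra_simps)
      also have "\<dots> \<le> norm (?x - ?y) * norm (f \<eta>) + norm ?y * norm (f \<eta> - g \<eta>)"
        by (intro norm_triangle_le add_mono)
           (simp_all only: norm_mult, auto intro!: mult_mono Finite_Cartesian_Product.norm_nth_le
              simp del: vector_minus_component)
      finally show "ennreal (norm (?x $ j * f \<eta> $ k - ?y $ j * g \<eta> $ k))
        \<le> ennreal (norm (?x - ?y)) * ennreal (norm (f \<eta>)) + ennreal (norm ?y) * ennreal (norm (f \<eta> - g \<eta>))"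
        by (simp add: ennreal_mult[symmetric] ennreal_plus[symmetric] ennreal_leI del: ennreal_plus)
    qed
    also have "\<dots> = ?C"
      unfolding econv_def by (subst nn_integral_add) auto
    finally show ?thesis unfolding c using c(2) by (simp add: ennreal_le_iff)
  qed
  from norm_nonlin_diff_le[of f \<xi> g c, OF this]
  have "norm (leray \<xi> (nonlin f \<xi>) - leray \<xi> (nonlin g \<xi>)) \<le> norm \<xi> / 6 * c"
    unfolding leray_diff by (intro order_trans[OF norm_leray_le]) simp
  then show ?thesis
    unfolding c using c(2) by (simp add: ennreal_mult[symmetric] ennreal_leI del: times_divide_eq_left)
qed

lemma norm_leray_nonlin_le:
  fixes f :: fvec
  assumes [measurable]: "f \<in> borel_measurable borel"
    and f: "econv (\<lambda>\<eta>. norm (f \<eta>)) (\<lambda>\<eta>. norm (f \<eta>)) \<xi> < \<infinity>"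
  shows "ennreal (norm (leray \<xi> (nonlin f \<xi>)))
     \<le> ennreal (norm \<xi> / 6) * econv (\<lambda>\<eta>. norm (f \<eta>)) (\<lambda>\<eta>. norm (f \<eta>)) \<xi>"
  using norm_leray_nonlin_diff_le[of f "\<lambda>_. 0" \<xi>] f by (simp add: econv_def)

section \<open>The flattened Gevrey weight\<close>

text \<open>Subtracting the constant after shifting by \<open>R\<close> keeps the exponent concave and vanishing at \<open>0\<close>, hence
  subadditive, while making it tend to \<open>0\<close> pointwise as \<open>R\<close> grows.\<close>

definition gweight :: "real \<Rightarrow> real \<Rightarrow> real \<Rightarrow> real^3 \<Rightarrow> real" where
  "gweight a \<theta> R \<xi> = exp (a * ((norm \<xi> + R) powr \<theta> - R powr \<theta>))"

text \<open>Concavity: the increment of x^\<theta> over a step of length \<open>s\<close> decreases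
  in the starting point, and the starting points \<open>r + R\<close> and \<open>R\<close> are
  compared. The shift keeps the derivative away from its singularity at 0.\<close>

lemma powr_shift_subadditive:
  fixes r s R \<theta> :: real
  assumes "0 \<le> r" "0 \<le> s" "0 < R" "0 < \<theta>" "\<theta> < 1"
  shows "(r + s + R) powr \<theta> - R powr \<theta> \<le> ((r + R) powr \<theta> - R powr \<theta>) + ((s + R) powr \<theta> - R powr \<theta>)"
proof -
  have "(r + R + s) powr \<theta> - (r + R) powr \<theta> \<le> (R + s) powr \<theta> - R powr \<theta>"
  proof (rule DERIV_nonpos_imp_nonincreasing[where f="\<lambda>x. (x + s) powr \<theta> - x powr \<theta>"])
    fix x assume x: "R \<le> x" "x \<le> r + R"
    have "((\<lambda>x. (x + s) powr \<theta> - x powr \<theta>) has_real_derivative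
        \<theta> * (x + s) powr (\<theta> - 1) - \<theta> * x powr (\<theta> - 1)) (at x)"
      using x assms by (auto intro!: derivative_eq_intros)
    moreover have "(x + s) powr (\<theta> - 1) \<le> x powr (\<theta> - 1)"
      using x assms by (intro powr_mono2') auto
    ultimately show "\<exists>y. ((\<lambda>x. (x + s) powr \<theta> - x powr \<theta>) has_real_derivative y) (at x) \<and> y \<le> 0"
      using assms by (intro exI[of _ "\<theta> * (x + s) powr (\<theta> - 1) - \<theta> * x powr (\<theta> - 1)"]) (auto simp: mult_left_mono)
  qed (use assms in auto)
  then show ?thesis by (simp add: algebra_simps)
qed

text \<open>Write x^\<theta> as x times the decreasing function x^(\<theta> - 1) and enlarge that
  factor separately in each summand.\<close>

lemma powr_subadditive:
  fixes r R \<theta> :: real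
  assumes "0 \<le> r" "0 \<le> R" "0 < \<theta>" "\<theta> < 1"
  shows "(r + R) powr \<theta> \<le> r powr \<theta> + R powr \<theta>"
proof (cases "r = 0 \<or> R = 0")
  case False
  then have pos: "r > 0" "R > 0" using assms by auto
  have split: "x powr \<theta> = x * x powr (\<theta> - 1)" if "x > 0" for x
    using that by (simp add: powr_diff)
  have "(r + R) powr \<theta> = r * (r + R) powr (\<theta> - 1) + R * (r + R) powr (\<theta> - 1)"
    using pos by (subst split) (auto simp: algebra_simps)
  also have "\<dots> \<le> r * r powr (\<theta> - 1) + R * R powr (\<theta> - 1)"
    using pos assms by (intro add_mono mult_left_mono powr_mono2') auto
  finally show ?thesis using pos by (simp add: split)
qed auto

lemma gweight_ge_1: "a > 0 \<Longrightarrow> R > 0 \<Longrightarrow> 0 < \<theta> \<Longrightarrow> 1 \<le> gweight a \<theta> R \<xi>"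
  unfolding gweight_def by (simp add: powr_mono2)

lemma gweight_submult:
  assumes "a > 0" "R > 0" "0 < \<theta>" "\<theta> < 1"
  shows "gweight a \<theta> R (\<xi> + \<eta>) \<le> gweight a \<theta> R \<xi> * gweight a \<theta> R \<eta>"
proof -
  have "(norm (\<xi> + \<eta>) + R) powr \<theta> \<le> (norm \<xi> + norm \<eta> + R) powr \<theta>"
    using assms norm_triangle_ineq[of \<xi> \<eta>] by (intro powr_mono2) auto
  with powr_shift_subadditive[of "norm \<xi>" "norm \<eta>" R \<theta>] assms
  have "(norm (\<xi> + \<eta>) + R) powr \<theta> - R powr \<theta>
     \<le> ((norm \<xi> + R) powr \<theta> - R powr \<theta>) + ((norm \<eta> + R) powr \<theta> - R powr \<theta>)" by simp
  then show ?thesis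
    unfolding gweight_def exp_add[symmetric] distrib_left[symmetric] using assms by (simp add: mult_left_mono)
qed

text \<open>The bound is uniform in \<open>R\<close>, which provides the dominating function when
  \<open>R\<close> tends to infinity.\<close>

lemma gweight_le_gevrey:
  assumes "a > 0" "R > 0" "0 < \<theta>" "\<theta> < 1"
  shows "gweight a \<theta> R \<xi> \<le> exp (a * norm \<xi> powr \<theta>)"
  unfolding gweight_def using assms powr_subadditive[of "norm \<xi>" R \<theta>] by simp

text \<open>The price of returning to the Gevrey weight is a constant depending on \<open>R\<close>.
  It is harmless because \<open>R\<close> is fixed before the equation is solved.\<close>

lemma gevrey_le_gweight:
  assumes "a > 0" "R > 0" "0 < \<theta>"
  shows "exp (a * norm \<xi> powr \<theta>) \<le> exp (a * R powr \<theta>) * gweight a \<theta> R \<xi>"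
  unfolding gweight_def exp_add[symmetric] using assms
  by (simp add: distrib_left[symmetric] powr_mono2 del: exp_add)

lemma gweight_measurable [measurable]: "gweight a \<theta> R \<in> borel_measurable borel"
  unfolding gweight_def[abs_def] by measurable

text \<open>The bracket in the exponent is at most |\<xi>| R^(\<theta> - 1), because x^(\<theta> -
  1) is decreasing, and this tends to 0 since \<theta> < 1.\<close>

lemma gweight_tendsto_1:
  assumes "0 < \<theta>" "\<theta> < 1"
  shows "(\<lambda>n. gweight a \<theta> (real (Suc n)) \<xi>) \<longlonglongrightarrow> 1"
proof -
  have bound: "(r + R) powr \<theta> - R powr \<theta> \<le> r * R powr (\<theta> - 1)" if "r \<ge> 0" "R > 0" for r R
  proof -
    have "(r + R) powr \<theta> = (r + R) * (r + R) powr (\<theta> - 1)"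
      using that by (simp add: powr_diff)
    also have "\<dots> \<le> (r + R) * R powr (\<theta> - 1)"
      using that assms by (intro mult_left_mono powr_mono2') auto
    also have "\<dots> = r * R powr (\<theta> - 1) + R powr \<theta>"
      using that by (simp add: distrib_right powr_diff add_divide_distrib)
    finally show ?thesis by simp
  qed
  have "(\<lambda>n. (norm \<xi> + real (Suc n)) powr \<theta> - real (Suc n) powr \<theta>) \<longlonglongrightarrow> 0"
  proof (rule tendsto_sandwich[where f="\<lambda>_. 0" and h="\<lambda>n. norm \<xi> * real (Suc n) powr (\<theta> - 1)"])
    show "(\<lambda>n. norm \<xi> * real (Suc n) powr (\<theta> - 1)) \<longlonglongrightarrow> 0"
      using assms
      by (intro tendsto_mult_right_zero tendsto_neg_powr filterlim_compose[OF filterlim_real_sequentially filterlim_Suc]) auto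
  qed (use bound assms in \<open>auto intro!: always_eventually powr_mono2\<close>)
  then have "(\<lambda>n. exp (a * ((norm \<xi> + real (Suc n)) powr \<theta> - real (Suc n) powr \<theta>))) \<longlonglongrightarrow> exp (a * 0)"
    by (intro tendsto_intros)
  then show ?thesis by (simp add: gweight_def)
qed

section \<open>Convolution and interpolation\<close>

lemma nn_integral_lborel_translate:
  fixes f :: "'a::euclidean_space \<Rightarrow> ennreal"
  assumes [measurable]: "f \<in> borel_measurable borel"
  shows "(\<integral>\<^sup>+ x. f (x - c) \<partial>lborel) = (\<integral>\<^sup>+ x. f x \<partial>lborel)"
proof -
  have "(\<integral>\<^sup>+ x. f x \<partial>lborel) = (\<integral>\<^sup>+ x. f x \<partial>distr lborel borel ((+) (- c)))"
    by (simp add: lborel_distr_plus)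
  also have "\<dots> = (\<integral>\<^sup>+ x. f (x - c) \<partial>lborel)"
    by (subst nn_integral_distr) auto
  finally show ?thesis ..
qed

lemma econv_measurable [measurable (raw)]:
  assumes [measurable]: "case_prod f \<in> borel_measurable (M \<Otimes>\<^sub>M borel)"
    "case_prod g \<in> borel_measurable (M \<Otimes>\<^sub>M borel)" "h \<in> borel_measurable M"
  shows "(\<lambda>x. econv (f x) (g x) (h x)) \<in> borel_measurable M"
  unfolding econv_def by measurable

lemma econv_mono:
  "(\<And>\<eta>. f \<eta> \<le> f' \<eta>) \<Longrightarrow> (\<And>\<eta>. g \<eta> \<le> g' \<eta>) \<Longrightarrow> econv f g \<xi> \<le> econv f' g' \<xi>"
  unfolding econv_def by (intro nn_integral_mono mult_mono) auto

lemma econv_add_left: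
  assumes [measurable]: "f \<in> borel_measurable borel" "f' \<in> borel_measurable borel" "g \<in> borel_measurable borel"
  shows "econv (\<lambda>\<eta>. f \<eta> + f' \<eta>) g \<xi> = econv f g \<xi> + econv f' g \<xi>"
  unfolding econv_def by (subst nn_integral_add[symmetric]) (auto simp: distrib_right)

lemma econv_add_right:
  assumes [measurable]: "f \<in> borel_measurable borel" "g' \<in> borel_measurable borel" "g \<in> borel_measurable borel"
  shows "econv f (\<lambda>\<eta>. g \<eta> + g' \<eta>) \<xi> = econv f g \<xi> + econv f g' \<xi>"
  unfolding econv_def by (subst nn_integral_add[symmetric]) (auto simp: distrib_left)

lemma nn_integral_econv:
  assumes [measurable]: "f \<in> borel_measurable borel" "g \<in> borel_measurable borel"
  shows "(\<integral>\<^sup>+ \<xi>. econv f g \<xi> \<partial>lborel) = (\<integral>\<^sup>+ \<xi>. f \<xi> \<partial>lborel) * (\<integral>\<^sup>+ \<xi>. g \<xi> \<partial>lborel)"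
proof -
  have "(\<integral>\<^sup>+ \<xi>. econv f g \<xi> \<partial>lborel) = (\<integral>\<^sup>+ \<eta>. (\<integral>\<^sup>+ \<xi>. f (\<xi> - \<eta>) * g \<eta> \<partial>lborel) \<partial>lborel)"
    unfolding econv_def by (rule lborel_pair.Fubini') measurable
  also have "\<dots> = (\<integral>\<^sup>+ \<eta>. (\<integral>\<^sup>+ \<xi>. f \<xi> \<partial>lborel) * g \<eta> \<partial>lborel)"
    by (subst nn_integral_multc) (auto simp: nn_integral_lborel_translate)
  finally show ?thesis by (simp add: nn_integral_cmult)
qed

text \<open>Since \<xi> = (\<xi> - \<eta>) + \<eta>, submultiplicativity moves the weight onto both
  factors under the integral: weighted L1 is a convolution algebra.\<close>

lemma nn_integral_weighted_econv_le:
  assumes [measurable]: "f \<in> borel_measurable borel" "g \<in> borel_measurable borel" "W \<in> borel_measurable borel"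
    and W: "\<And>\<xi> \<eta>. W (\<xi> + \<eta>) \<le> W \<xi> * W \<eta>"
  shows "(\<integral>\<^sup>+ \<xi>. W \<xi> * econv f g \<xi> \<partial>lborel) \<le> (\<integral>\<^sup>+ \<xi>. W \<xi> * f \<xi> \<partial>lborel) * (\<integral>\<^sup>+ \<xi>. W \<xi> * g \<xi> \<partial>lborel)"
proof -
  have "W \<xi> * econv f g \<xi> \<le> econv (\<lambda>\<xi>. W \<xi> * f \<xi>) (\<lambda>\<xi>. W \<xi> * g \<xi>) \<xi>" for \<xi>
  proof -
    have "W \<xi> * econv f g \<xi> = (\<integral>\<^sup>+ \<eta>. W \<xi> * (f (\<xi> - \<eta>) * g \<eta>) \<partial>lborel)"
      unfolding econv_def by (rule nn_integral_cmult[symmetric]) measurable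
    also have "\<dots> \<le> (\<integral>\<^sup>+ \<eta>. (W (\<xi> - \<eta>) * W \<eta>) * (f (\<xi> - \<eta>) * g \<eta>) \<partial>lborel)"
      using W[of "\<xi> - \<eta>" \<eta> for \<eta>] by (intro nn_integral_mono mult_right_mono) auto
    finally show ?thesis unfolding econv_def by (simp add: mult_ac)
  qed
  then show ?thesis
    by (subst nn_integral_econv[symmetric]) (auto intro: nn_integral_mono)
qed

lemma AE_lborel_neq0: "AE \<xi> in lborel. \<xi> \<noteq> (0::'a::euclidean_space)"
  by (rule AE_lborel_singleton)

text \<open>Cauchy--Schwarz for the measure with density \<open>f\<close>, applied to 1 =
  |\<xi>|^(-1/2) |\<xi>|^(1/2), which holds off the origin.\<close>

lemma L1_interpolation:
  fixes f :: "'a::euclidean_space \<Rightarrow> ennreal"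
  assumes [measurable]: "f \<in> borel_measurable borel"
  shows "(\<integral>\<^sup>+ \<xi>. f \<xi> \<partial>lborel)\<^sup>2
    \<le> (\<integral>\<^sup>+ \<xi>. inverse (norm \<xi>) * f \<xi> \<partial>lborel) * (\<integral>\<^sup>+ \<xi>. norm \<xi> * f \<xi> \<partial>lborel)"
proof -
  let ?M = "density lborel f"
  have "(\<integral>\<^sup>+ \<xi>. f \<xi> \<partial>lborel)
      = (\<integral>\<^sup>+ \<xi>. f \<xi> * (ennreal (sqrt (inverse (norm \<xi>))) * ennreal (sqrt (norm \<xi>))) \<partial>lborel)"
  proof (rule nn_integral_cong_AE, rule AE_mp[OF AE_lborel_neq0], rule AE_I2, rule impI)
    fix \<xi> :: 'a assume "\<xi> \<noteq> 0"
    then have "ennreal (sqrt (inverse (norm \<xi>))) * ennreal (sqrt (norm \<xi>)) = 1"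
      by (subst ennreal_mult[symmetric]) (simp_all add: real_sqrt_inverse)
    then show "f \<xi> = f \<xi> * (ennreal (sqrt (inverse (norm \<xi>))) * ennreal (sqrt (norm \<xi>)))" by simp
  qed
  also have "\<dots> = (\<integral>\<^sup>+ \<xi>. ennreal (sqrt (inverse (norm \<xi>))) * ennreal (sqrt (norm \<xi>)) \<partial>?M)"
    by (subst nn_integral_density) auto
  also have "\<dots>\<^sup>2 \<le> (\<integral>\<^sup>+ \<xi>. (ennreal (sqrt (inverse (norm \<xi>))))\<^sup>2 \<partial>?M) * (\<integral>\<^sup>+ \<xi>. (ennreal (sqrt (norm \<xi>)))\<^sup>2 \<partial>?M)"
    by (rule Cauchy_Schwarz_nn_integral) auto
  also have "\<dots> = (\<integral>\<^sup>+ \<xi>. inverse (norm \<xi>) * f \<xi> \<partial>lborel) * (\<integral>\<^sup>+ \<xi>. norm \<xi> * f \<xi> \<partial>lborel)"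
    by (simp add: ennreal_power nn_integral_density mult.commute)
  finally show ?thesis .
qed

section \<open>The heat semigroup in time\<close>

text \<open>Used with c = \<nu> |\<xi>|^2; this is the gain of two derivatives by the heat
  flow.\<close>

lemma nn_integral_exp_decay:
  fixes c s :: real
  assumes "c > 0"
  shows "(\<integral>\<^sup>+ t. indicator {s..} t * ennreal (exp (- c * (t - s))) \<partial>lborel) = ennreal (1 / c)"
proof -
  have "LIM t at_top. - s + t :> at_top"
    by (intro filterlim_tendsto_add_at_top[OF tendsto_const] filterlim_ident)
  then have "((\<lambda>t. - exp (- c * (t - s)) / c) \<longlongrightarrow> - 0 / c) at_top"
    using assms
    by (intro tendsto_intros filterlim_compose[OF exp_at_bot] filterlim_tendsto_neg_mult_at_bot[OF tendsto_const])
       auto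
  then have "(\<integral>\<^sup>+ t. ennreal (exp (- c * (t - s))) * indicator {s..} t \<partial>lborel)
    = ennreal (0 - (- exp (- c * (s - s)) / c))"
    using assms
    by (intro nn_integral_FTC_atLeast) (auto intro!: derivative_eq_intros simp: field_simps)
  then show ?thesis by (simp add: mult.commute)
qed

text \<open>In the Fubini arguments the endpoints are themselves integration variables, so
  measurability is needed jointly in endpoints and point.\<close>

lemma indicator_interval_measurable [measurable (raw)]:
  fixes f g h :: "'a \<Rightarrow> real"
  assumes [measurable]: "f \<in> borel_measurable M" "g \<in> borel_measurable M" "h \<in> borel_measurable M"
  shows "(\<lambda>x. indicator {f x..g x} (h x) :: ennreal) \<in> borel_measurable M"
    and "(\<lambda>x. indicator {f x..g x} (h x) :: real) \<in> borel_measurable M"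
    and "(\<lambda>x. indicator {f x..} (h x) :: ennreal) \<in> borel_measurable M"
  unfolding indicator_def atLeastAtMost_iff atLeast_iff by measurable

text \<open>Scalar counterpart of the Duhamel integral; \<open>norm \<xi> / 6\<close> is the factor
  by which a convolution bounds the projected nonlinearity.\<close>

definition eduhamel :: "real \<Rightarrow> (real \<Rightarrow> real^3 \<Rightarrow> ennreal) \<Rightarrow> real \<Rightarrow> real^3 \<Rightarrow> ennreal" where
  "eduhamel \<nu> h t \<xi> = (\<integral>\<^sup>+ s. indicator {0..t} s * (ennreal (exp (- \<nu> * (t - s) * (norm \<xi>)\<^sup>2)) *
      (ennreal (norm \<xi> / 6) * h s \<xi>)) \<partial>lborel)"

lemma eduhamel_measurable [measurable (raw)]:
  assumes [measurable]: "case_prod h \<in> borel_measurable (borel \<Otimes>\<^sub>M borel)"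
    "t \<in> borel_measurable M" "k \<in> borel_measurable M"
  shows "(\<lambda>x. eduhamel \<nu> h (t x) (k x)) \<in> borel_measurable M"
  unfolding eduhamel_def by measurable

lemma eduhamel_mono:
  "(\<And>s. 0 \<le> s \<Longrightarrow> s \<le> t \<Longrightarrow> h s \<xi> \<le> h' s \<xi>) \<Longrightarrow> eduhamel \<nu> h t \<xi> \<le> eduhamel \<nu> h' t \<xi>"
  unfolding eduhamel_def by (intro nn_integral_mono) (auto split: split_indicator intro!: mult_left_mono)

lemma eduhamel_add:
  assumes [measurable]: "case_prod h \<in> borel_measurable (borel \<Otimes>\<^sub>M borel)"
    "case_prod h' \<in> borel_measurable (borel \<Otimes>\<^sub>M borel)"
  shows "eduhamel \<nu> (\<lambda>s \<xi>. h s \<xi> + h' s \<xi>) t \<xi> = eduhamel \<nu> h t \<xi> + eduhamel \<nu> h' t \<xi>"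
  unfolding eduhamel_def by (subst nn_integral_add[symmetric]) (auto simp: distrib_left)

text \<open>The kernel is at most 1 and the range of \<open>s\<close> may be enlarged, so the bound
  does not depend on \<open>t\<close>.\<close>

lemma eduhamel_le:
  assumes [measurable]: "case_prod h \<in> borel_measurable (borel \<Otimes>\<^sub>M borel)" and "\<nu> > 0"
  shows "eduhamel \<nu> h t \<xi> \<le> ennreal (norm \<xi> / 6) * (\<integral>\<^sup>+ s. indicator {0..} s * h s \<xi> \<partial>lborel)"
proof -
  have "eduhamel \<nu> h t \<xi> \<le> (\<integral>\<^sup>+ s. ennreal (norm \<xi> / 6) * (indicator {0..} s * h s \<xi>) \<partial>lborel)"
    unfolding eduhamel_def
  proof (rule nn_integral_mono)
    fix s
    show "indicator {0..t} s * (ennreal (exp (- \<nu> * (t - s) * (norm \<xi>)\<^sup>2)) * (ennreal (norm \<xi> / 6) * h s \<xi>))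
       \<le> ennreal (norm \<xi> / 6) * (indicator {0..} s * h s \<xi>)"
    proof (cases "0 \<le> s \<and> s \<le> t")
      case True
      then have "- \<nu> * (t - s) * (norm \<xi>)\<^sup>2 \<le> 0"
        using assms by (simp add: mult_nonneg_nonneg)
      then have "ennreal (exp (- \<nu> * (t - s) * (norm \<xi>)\<^sup>2)) \<le> 1"
        by (subst ennreal_1[symmetric], intro ennreal_leI) simp
      from mult_right_mono[OF this, of "ennreal (norm \<xi> / 6) * h s \<xi>"] True
      show ?thesis by simp
    qed (auto split: split_indicator)
  qed
  also have "\<dots> = ennreal (norm \<xi> / 6) * (\<integral>\<^sup>+ s. indicator {0..} s * h s \<xi> \<partial>lborel)"
    by (rule nn_integral_cmult) measurable
  finally show ?thesis .
qed

text \<open>Tonelli turns 0 \<le> s \<le> t into t \<ge> s for fixed \<open>s\<close>, where the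
  kernel has mass 1 / (\<nu> |\<xi>|^2) whatever \<open>s\<close> is.\<close>

lemma nn_integral_eduhamel:
  assumes [measurable]: "case_prod h \<in> borel_measurable (borel \<Otimes>\<^sub>M borel)" and "\<nu> > 0" "\<xi> \<noteq> 0"
  shows "(\<integral>\<^sup>+ t. indicator {0..} t * eduhamel \<nu> h t \<xi> \<partial>lborel)
     = ennreal (1 / (\<nu> * (norm \<xi>)\<^sup>2)) * (ennreal (norm \<xi> / 6) * (\<integral>\<^sup>+ s. indicator {0..} s * h s \<xi> \<partial>lborel))"
proof -
  let ?c = "\<nu> * (norm \<xi>)\<^sup>2"
  have "(\<integral>\<^sup>+ t. indicator {0..} t * eduhamel \<nu> h t \<xi> \<partial>lborel)
     = (\<integral>\<^sup>+ t. (\<integral>\<^sup>+ s. (indicator {0..} s * (ennreal (norm \<xi> / 6) * h s \<xi>)) *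
           (indicator {s..} t * ennreal (exp (- ?c * (t - s)))) \<partial>lborel) \<partial>lborel)"
    unfolding eduhamel_def
    by (subst nn_integral_cmult[symmetric], measurable, intro nn_integral_cong)
       (auto split: split_indicator simp: mult_ac)
  also have "\<dots> = (\<integral>\<^sup>+ s. (\<integral>\<^sup>+ t. (indicator {0..} s * (ennreal (norm \<xi> / 6) * h s \<xi>)) *
           (indicator {s..} t * ennreal (exp (- ?c * (t - s)))) \<partial>lborel) \<partial>lborel)"
    by (rule lborel_pair.Fubini') measurable
  also have "\<dots> = (\<integral>\<^sup>+ s. (indicator {0..} s * (ennreal (norm \<xi> / 6) * h s \<xi>)) * ennreal (1 / ?c) \<partial>lborel)"
  proof (rule nn_integral_cong)
    fix s
    have "(\<integral>\<^sup>+ t. indicator {s..} t * ennreal (exp (- ?c * (t - s))) \<partial>lborel) = ennreal (1 / ?c)"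
      using assms by (intro nn_integral_exp_decay) auto
    then show "(\<integral>\<^sup>+ t. (indicator {0..} s * (ennreal (norm \<xi> / 6) * h s \<xi>)) *
           (indicator {s..} t * ennreal (exp (- ?c * (t - s)))) \<partial>lborel)
       = (indicator {0..} s * (ennreal (norm \<xi> / 6) * h s \<xi>)) * ennreal (1 / ?c)"
      by (subst nn_integral_cmult) auto
  qed
  also have "\<dots> = (\<integral>\<^sup>+ s. (ennreal (1 / ?c) * ennreal (norm \<xi> / 6)) * (indicator {0..} s * h s \<xi>) \<partial>lborel)"
    by (simp add: mult_ac)
  also have "\<dots> = ennreal (1 / ?c) * (ennreal (norm \<xi> / 6) * (\<integral>\<^sup>+ s. indicator {0..} s * h s \<xi> \<partial>lborel))"
    by (subst nn_integral_cmult) (auto simp: mult.assoc)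
  finally show ?thesis .
qed

text \<open>At a fixed time the algebra property and interpolation give the product of the masses of
  W f / |\<xi>| and |\<xi>| W f. The first is bounded uniformly in time through \<open>fG\<close>;
  the second is integrated in time through \<open>intf\<close>, where |\<xi>| / (\<nu> |\<xi>|^2)
  restores the weight 1 / |\<xi>|.\<close>

lemma weighted_econv_time_bound:
  fixes f :: "real \<Rightarrow> real^3 \<Rightarrow> ennreal" and G W :: "real^3 \<Rightarrow> ennreal"
  assumes [measurable]: "case_prod f \<in> borel_measurable (borel \<Otimes>\<^sub>M borel)"
      "G \<in> borel_measurable borel" "W \<in> borel_measurable borel"
    and W: "\<And>\<xi> \<eta>. W (\<xi> + \<eta>) \<le> W \<xi> * W \<eta>" and "\<nu> > 0"
    and fG: "\<And>s \<xi>. s \<ge> 0 \<Longrightarrow> f s \<xi> \<le> G \<xi>"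
    and intf: "\<And>\<xi>. \<xi> \<noteq> 0 \<Longrightarrow> (\<integral>\<^sup>+ s. indicator {0..} s * f s \<xi> \<partial>lborel) \<le> ennreal (1 / (\<nu> * (norm \<xi>)\<^sup>2)) * G \<xi>"
  shows "(\<integral>\<^sup>+ \<xi>. W \<xi> * (\<integral>\<^sup>+ s. indicator {0..} s * econv (f s) (f s) \<xi> \<partial>lborel) \<partial>lborel)
    \<le> ennreal (1 / \<nu>) * (\<integral>\<^sup>+ \<xi>. inverse (norm \<xi>) * (W \<xi> * G \<xi>) \<partial>lborel)\<^sup>2"
proof -
  define g where "g = (\<integral>\<^sup>+ \<xi>. inverse (norm \<xi>) * (W \<xi> * G \<xi>) \<partial>lborel)"
  have "(\<integral>\<^sup>+ \<xi>. W \<xi> * (\<integral>\<^sup>+ s. indicator {0..} s * econv (f s) (f s) \<xi> \<partial>lborel) \<partial>lborel)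
     = (\<integral>\<^sup>+ \<xi>. (\<integral>\<^sup>+ s. indicator {0..} s * (W \<xi> * econv (f s) (f s) \<xi>) \<partial>lborel) \<partial>lborel)"
    by (subst nn_integral_cmult[symmetric]) (auto intro!: nn_integral_cong simp: mult_ac)
  also have "\<dots> = (\<integral>\<^sup>+ s. (\<integral>\<^sup>+ \<xi>. indicator {0..} s * (W \<xi> * econv (f s) (f s) \<xi>) \<partial>lborel) \<partial>lborel)"
    by (rule lborel_pair.Fubini') measurable
  also have "\<dots> \<le> (\<integral>\<^sup>+ s. g * (indicator {0..} s * (\<integral>\<^sup>+ \<xi>. norm \<xi> * (W \<xi> * f s \<xi>) \<partial>lborel)) \<partial>lborel)"
  proof (rule nn_integral_mono)
    fix s :: real
    have "(\<integral>\<^sup>+ \<xi>. W \<xi> * econv (f s) (f s) \<xi> \<partial>lborel) \<le> g * (\<integral>\<^sup>+ \<xi>. norm \<xi> * (W \<xi> * f s \<xi>) \<partial>lborel)"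
      if "s \<ge> 0"
    proof -
      have "(\<integral>\<^sup>+ \<xi>. W \<xi> * econv (f s) (f s) \<xi> \<partial>lborel) \<le> (\<integral>\<^sup>+ \<xi>. W \<xi> * f s \<xi> \<partial>lborel)\<^sup>2"
        unfolding power2_eq_square by (rule nn_integral_weighted_econv_le) (auto intro: W)
      also have "\<dots> \<le> (\<integral>\<^sup>+ \<xi>. inverse (norm \<xi>) * (W \<xi> * f s \<xi>) \<partial>lborel) * (\<integral>\<^sup>+ \<xi>. norm \<xi> * (W \<xi> * f s \<xi>) \<partial>lborel)"
        by (rule L1_interpolation) measurable
      also have "\<dots> \<le> g * (\<integral>\<^sup>+ \<xi>. norm \<xi> * (W \<xi> * f s \<xi>) \<partial>lborel)"
        unfolding g_def using fG[OF that]
        by (intro mult_right_mono nn_integral_mono mult_left_mono) auto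
      finally show ?thesis .
    qed
    then show "(\<integral>\<^sup>+ \<xi>. indicator {0..} s * (W \<xi> * econv (f s) (f s) \<xi>) \<partial>lborel)
       \<le> g * (indicator {0..} s * (\<integral>\<^sup>+ \<xi>. norm \<xi> * (W \<xi> * f s \<xi>) \<partial>lborel))"
      by (auto split: split_indicator)
  qed
  also have "\<dots> = g * (\<integral>\<^sup>+ s. (\<integral>\<^sup>+ \<xi>. indicator {0..} s * (norm \<xi> * (W \<xi> * f s \<xi>)) \<partial>lborel) \<partial>lborel)"
    by (subst nn_integral_cmult) (auto simp: nn_integral_cmult)
  also have "(\<integral>\<^sup>+ s. (\<integral>\<^sup>+ \<xi>. indicator {0..} s * (norm \<xi> * (W \<xi> * f s \<xi>)) \<partial>lborel) \<partial>lborel)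
    = (\<integral>\<^sup>+ \<xi>. (\<integral>\<^sup>+ s. indicator {0..} s * (norm \<xi> * (W \<xi> * f s \<xi>)) \<partial>lborel) \<partial>lborel)"
    by (rule lborel_pair.Fubini'[symmetric]) measurable
  also have "\<dots> = (\<integral>\<^sup>+ \<xi>. norm \<xi> * W \<xi> * (\<integral>\<^sup>+ s. indicator {0..} s * f s \<xi> \<partial>lborel) \<partial>lborel)"
    by (subst nn_integral_cmult[symmetric]) (auto intro!: nn_integral_cong simp: mult_ac)
  also have "\<dots> \<le> (\<integral>\<^sup>+ \<xi>. ennreal (1 / \<nu>) * (inverse (norm \<xi>) * (W \<xi> * G \<xi>)) \<partial>lborel)"
  proof (rule nn_integral_mono_AE, rule AE_mp[OF AE_lborel_neq0], rule AE_I2, rule impI)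
    fix \<xi> :: "real^3" assume \<xi>: "\<xi> \<noteq> 0"
    have "norm \<xi> * W \<xi> * (\<integral>\<^sup>+ s. indicator {0..} s * f s \<xi> \<partial>lborel)
      \<le> norm \<xi> * W \<xi> * (ennreal (1 / (\<nu> * (norm \<xi>)\<^sup>2)) * G \<xi>)"
      by (intro mult_left_mono intf \<xi>) auto
    also have "\<dots> = (ennreal (norm \<xi>) * ennreal (1 / (\<nu> * (norm \<xi>)\<^sup>2))) * (W \<xi> * G \<xi>)"
      by (simp add: mult_ac)
    also have "ennreal (norm \<xi>) * ennreal (1 / (\<nu> * (norm \<xi>)\<^sup>2)) = ennreal (1 / \<nu>) * ennreal (inverse (norm \<xi>))"
      using \<xi> \<open>\<nu> > 0\<close> by (simp add: ennreal_mult[symmetric] field_simps power2_eq_square)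
    finally show "norm \<xi> * W \<xi> * (\<integral>\<^sup>+ s. indicator {0..} s * f s \<xi> \<partial>lborel)
       \<le> ennreal (1 / \<nu>) * (inverse (norm \<xi>) * (W \<xi> * G \<xi>))" by (simp add: mult_ac)
  qed
  also have "\<dots> = ennreal (1 / \<nu>) * g"
    unfolding g_def by (rule nn_integral_cmult) measurable
  finally have "(\<integral>\<^sup>+ \<xi>. W \<xi> * (\<integral>\<^sup>+ s. indicator {0..} s * econv (f s) (f s) \<xi> \<partial>lborel) \<partial>lborel)
    \<le> g * (ennreal (1 / \<nu>) * g)"
    by (meson mult_left_mono zero_le)
  then show ?thesis
    unfolding g_def[symmetric] by (simp add: power2_eq_square mult_ac)
qed

section \<open>Reflection, joint measurability, differences of Duhamel integrals and conjugation
  symmetry\<close>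

lemma lborel_distr_reflect:
  fixes c :: "'a::euclidean_space"
  shows "distr lborel borel (\<lambda>x. c - x) = lborel"
  by (subst (2) lborel_affine[of "-1" c]) (auto simp: density_1)

lemma nn_integral_lborel_reflect:
  fixes f :: "'a::euclidean_space \<Rightarrow> ennreal"
  assumes [measurable]: "f \<in> borel_measurable borel"
  shows "(\<integral>\<^sup>+ x. f (c - x) \<partial>lborel) = (\<integral>\<^sup>+ x. f x \<partial>lborel)"
proof -
  have "(\<integral>\<^sup>+ x. f x \<partial>lborel) = (\<integral>\<^sup>+ x. f x \<partial>distr lborel borel (\<lambda>x. c - x))"
    by (simp add: lborel_distr_reflect)
  also have "\<dots> = (\<integral>\<^sup>+ x. f (c - x) \<partial>lborel)"
    by (subst nn_integral_distr) auto
  finally show ?thesis ..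
qed

lemma integral_lborel_uminus:
  fixes f :: "'a::euclidean_space \<Rightarrow> complex"
  assumes [measurable]: "f \<in> borel_measurable borel"
  shows "(\<integral> x. f (- x) \<partial>lborel) = (\<integral> x. f x \<partial>lborel)"
proof -
  have "(\<integral> x. f x \<partial>lborel) = (\<integral> x. f x \<partial>distr lborel borel (\<lambda>x. 0 - x))"
    by (simp only: lborel_distr_reflect)
  also have "\<dots> = (\<integral> x. f (0 - x) \<partial>lborel)"
    by (subst integral_distr) auto
  finally show ?thesis by simp
qed

lemma AE_lborel_reflect:
  fixes c :: "'a::euclidean_space"
  assumes "AE x in lborel. P x"
  shows "AE x in lborel. P (c - x)"
proof -
  obtain N where N: "N \<in> null_sets lborel" "{x. \<not> P x} \<subseteq> N"
    using assms by (auto elim!: AE_E simp: null_sets_def)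
  have "AE x in lborel. x \<notin> N" using N by (rule_tac AE_not_in)
  then have "AE x in distr lborel borel (\<lambda>x. c - x). x \<notin> N"
    unfolding lborel_distr_reflect .
  then have "AE x in lborel. c - x \<notin> N"
    using N by (subst (asm) AE_distr_iff) (auto simp: null_sets_def)
  then show ?thesis by eventually_elim (use N in auto)
qed

lemma econv_commute:
  assumes [measurable]: "f \<in> borel_measurable borel" "g \<in> borel_measurable borel"
  shows "econv f g \<xi> = econv g f \<xi>"
  unfolding econv_def by (subst nn_integral_lborel_reflect[symmetric, of _ \<xi>]) (auto simp: mult.commute)

lemma vec_lambda_borel_measurable [measurable (raw)]:
  fixes f :: "'a \<Rightarrow> 'n::finite \<Rightarrow> 'b::euclidean_space"
  assumes "\<And>k. (\<lambda>x. f x k) \<in> borel_measurable M"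
  shows "(\<lambda>x. \<chi> k. f x k) \<in> borel_measurable M"
proof (subst borel_measurable_euclidean_space, rule ballI)
  fix b :: "'b^'n" assume "b \<in> Basis"
  then obtain i v where b: "b = axis i v" by (auto simp: Basis_vec_def)
  show "(\<lambda>x. (\<chi> k. f x k) \<bullet> b) \<in> borel_measurable M"
    using assms[of i] by (simp add: b inner_axis)
qed

lemma leray_measurable [measurable (raw)]:
  assumes [measurable]: "f \<in> borel_measurable M" "v \<in> borel_measurable M"
  shows "(\<lambda>x. leray (f x) (v x)) \<in> borel_measurable M"
  unfolding leray_def by measurable

lemma nonlin_measurable [measurable (raw)]:
  assumes [measurable]: "case_prod f \<in> borel_measurable (M \<Otimes>\<^sub>M borel)" "h \<in> borel_measurable M"
  shows "(\<lambda>x. nonlin (f x) (h x)) \<in> borel_measurable M"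
  unfolding nonlin_def by measurable

lemma duhamel_integrand_measurable [measurable (raw)]:
  assumes [measurable]: "case_prod u \<in> borel_measurable (borel \<Otimes>\<^sub>M borel)"
    "t \<in> borel_measurable M" "k \<in> borel_measurable M" "s \<in> borel_measurable M"
  shows "(\<lambda>x. duhamel_integrand \<nu> u (t x) (k x) (s x)) \<in> borel_measurable M"
  unfolding duhamel_integrand_def by measurable

text \<open>Finite convolutions are required because the Bochner integral in \<open>nonlin\<close>
  takes the default value 0 when it diverges, and the difference could then not be expanded
  bilinearly. Integrability in time permits subtracting the two integrals.\<close>

lemma norm_duhamel_integral_diff_le:
  fixes u v :: "real \<Rightarrow> fvec"
  assumes [measurable]: "case_prod u \<in> borel_measurable (borel \<Otimes>\<^sub>M borel)"
      "case_prod v \<in> borel_measurable (borel \<Otimes>\<^sub>M borel)"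
    and int: "set_integrable lborel {0..t} (duhamel_integrand \<nu> u t \<xi>)"
      "set_integrable lborel {0..t} (duhamel_integrand \<nu> v t \<xi>)"
    and fin: "AE s in lborel. 0 \<le> s \<and> s \<le> t \<longrightarrow>
        econv (\<lambda>\<eta>. norm (u s \<eta>)) (\<lambda>\<eta>. norm (u s \<eta>)) \<xi> < \<infinity> \<and>
        econv (\<lambda>\<eta>. norm (v s \<eta>)) (\<lambda>\<eta>. norm (v s \<eta>)) \<xi> < \<infinity>"
  shows "ennreal (norm ((LINT s:{0..t}|lborel. duhamel_integrand \<nu> u t \<xi> s)
                      - (LINT s:{0..t}|lborel. duhamel_integrand \<nu> v t \<xi> s)))
    \<le> eduhamel \<nu> (\<lambda>s \<xi>. econv (\<lambda>\<eta>. norm (u s \<eta> - v s \<eta>)) (\<lambda>\<eta>. norm (u s \<eta>)) \<xi>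
                       + econv (\<lambda>\<eta>. norm (v s \<eta>)) (\<lambda>\<eta>. norm (u s \<eta> - v s \<eta>)) \<xi>) t \<xi>"
proof -
  let ?d = "\<lambda>s. indicator {0..t} s *\<^sub>R duhamel_integrand \<nu> u t \<xi> s - indicator {0..t} s *\<^sub>R duhamel_integrand \<nu> v t \<xi> s"
  have "ennreal (norm ((LINT s:{0..t}|lborel. duhamel_integrand \<nu> u t \<xi> s)
          - (LINT s:{0..t}|lborel. duhamel_integrand \<nu> v t \<xi> s))) = ennreal (norm (LINT s|lborel. ?d s))"
    using int unfolding set_integrable_def set_lebesgue_integral_def by simp
  also have "\<dots> \<le> (\<integral>\<^sup>+ s. norm (?d s) \<partial>lborel)"
    using int unfolding set_integrable_def by (intro integral_norm_bound_ennreal) auto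
  also have "\<dots> \<le> eduhamel \<nu> (\<lambda>s \<xi>. econv (\<lambda>\<eta>. norm (u s \<eta> - v s \<eta>)) (\<lambda>\<eta>. norm (u s \<eta>)) \<xi>
                       + econv (\<lambda>\<eta>. norm (v s \<eta>)) (\<lambda>\<eta>. norm (u s \<eta> - v s \<eta>)) \<xi>) t \<xi>"
    unfolding eduhamel_def
  proof (rule nn_integral_mono_AE, use fin in eventually_elim)
    case (elim s)
    show ?case
    proof (cases "0 \<le> s \<and> s \<le> t")
      case True
      let ?e = "exp (- \<nu> * (t - s) * (norm \<xi>)\<^sup>2)"
      have "?d s = ?e *\<^sub>R (leray \<xi> (nonlin (u s) \<xi>) - leray \<xi> (nonlin (v s) \<xi>))"
        using True by (simp add: duhamel_integrand_def scaleR_diff_right)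
      then have "ennreal (norm (?d s)) = ennreal ?e * ennreal (norm (leray \<xi> (nonlin (u s) \<xi>) - leray \<xi> (nonlin (v s) \<xi>)))"
        by (simp add: ennreal_mult)
      also have "\<dots> \<le> ennreal ?e * (ennreal (norm \<xi> / 6) *
           (econv (\<lambda>\<eta>. norm (u s \<eta> - v s \<eta>)) (\<lambda>\<eta>. norm (u s \<eta>)) \<xi>
            + econv (\<lambda>\<eta>. norm (v s \<eta>)) (\<lambda>\<eta>. norm (u s \<eta> - v s \<eta>)) \<xi>))"
        using elim True by (intro mult_left_mono norm_leray_nonlin_diff_le) auto
      finally show ?thesis using True by simp
    qed (auto split: split_indicator)
  qed
  finally show ?thesis .
qed

text \<open>Packaged as a bounded real-linear map so that conjugation commutes with Bochner
  integrals and limits.\<close>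

definition vcnj :: "complex^3 \<Rightarrow> complex^3" where "vcnj v = (\<chi> k. cnj (v $ k))"

lemma vcnj_nth [simp]: "vcnj v $ k = cnj (v $ k)"
  by (simp add: vcnj_def)

lemma bounded_linear_vcnj: "bounded_linear vcnj"
proof (rule bounded_linear_intro)
  show "norm (vcnj v) \<le> norm v * 1" for v by (simp add: norm_vec_def)
qed (simp_all add: vec_eq_iff)

lemma leray_uminus_vcnj: "leray (- \<xi>) (vcnj v) = vcnj (leray \<xi> v)"
  by (simp add: leray_def vec_eq_iff sum_negf)

text \<open>Substitute -\<eta> for \<eta>; the conjugate of \<i> \<xi>_j is \<i> (-\<xi>)_j. The
  symmetry of \<open>f\<close> is used only under the integral, so an almost everywhere hypothesis
  yields the identity at every \<xi>.\<close>

lemma nonlin_uminus: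
  assumes [measurable]: "f \<in> borel_measurable borel" and real: "real_field f"
  shows "nonlin f (- \<xi>) = vcnj (nonlin f \<xi>)"
proof -
  have "(\<integral>\<eta>. f (- \<xi> - \<eta>) $ j * f \<eta> $ k \<partial>lborel) = cnj (\<integral>\<eta>. f (\<xi> - \<eta>) $ j * f \<eta> $ k \<partial>lborel)" for j k
  proof -
    have re: "AE \<eta> in lborel. f (- \<eta>) = vcnj (f \<eta>)"
      using real by (simp add: real_field_def vcnj_def)
    have "(\<integral>\<eta>. f (- \<xi> - \<eta>) $ j * f \<eta> $ k \<partial>lborel) = (\<integral>\<eta>. f (- \<xi> - - \<eta>) $ j * f (- \<eta>) $ k \<partial>lborel)"
      by (rule integral_lborel_uminus[symmetric]) measurable
    also have "\<dots> = (\<integral>\<eta>. cnj (f (\<xi> - \<eta>) $ j * f \<eta> $ k) \<partial>lborel)"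
    proof (rule integral_cong_AE)
      show "AE \<eta> in lborel. f (- \<xi> - - \<eta>) $ j * f (- \<eta>) $ k = cnj (f (\<xi> - \<eta>) $ j * f \<eta> $ k)"
        using re AE_lborel_reflect[OF re, of \<xi>] by eventually_elim (simp add: minus_diff_commute)
      show "(\<lambda>\<eta>. cnj (f (\<xi> - \<eta>) $ j * f \<eta> $ k)) \<in> borel_measurable lborel"
        by (intro borel_measurable_continuous_on[where f=cnj] continuous_intros) measurable
    qed measurable
    finally show ?thesis by (simp only: Bochner_Integration.integral_cnj)
  qed
  then show ?thesis by (simp add: nonlin_def vec_eq_iff sum_negf)
qed

lemma powr_minus1: "norm \<xi> powr (-1) = inverse (norm \<xi>)"
  by (simp add: powr_minus)

lemma Z_norm_minus1_eq:
  "Z_norm (-1) a \<sigma> f = (\<integral>\<^sup>+ \<xi>. inverse (norm \<xi>) * (ennreal (exp (a * norm \<xi> powr (1 / \<sigma>))) * norm (f \<xi>)) \<partial>lborel)"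
  unfolding Z_norm_def powr_minus1 by (simp add: ennreal_mult mult.assoc)

lemma Z_norm_1_eq:
  "Z_norm 1 a \<sigma> f = (\<integral>\<^sup>+ \<xi>. norm \<xi> * (ennreal (exp (a * norm \<xi> powr (1 / \<sigma>))) * norm (f \<xi>)) \<partial>lborel)"
  unfolding Z_norm_def by (simp add: ennreal_mult mult.assoc)

section \<open>Majorants for small data\<close>

locale small_data =
  fixes \<nu> :: real and u0 :: fvec and W :: "real^3 \<Rightarrow> ennreal"
  assumes nu_pos: "\<nu> > 0"
    and u0_measurable [measurable]: "u0 \<in> borel_measurable borel"
    and W_measurable [measurable]: "W \<in> borel_measurable borel"
    and W_submult: "\<And>\<xi> \<eta>. W (\<xi> + \<eta>) \<le> W \<xi> * W \<eta>"
    and W_ge_1: "\<And>\<xi>. 1 \<le> W \<xi>"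
    and u0_small: "(\<integral>\<^sup>+ \<xi>. inverse (norm \<xi>) * (W \<xi> * norm (u0 \<xi>)) \<partial>lborel) \<le> ennreal \<nu>"
begin

text \<open>Started from 0 with nonnegative terms, this scalar iteration is increasing, so its limit
  exists for free. Its increments will dominate those of the vector iteration.\<close>

primrec major :: "nat \<Rightarrow> real \<Rightarrow> real^3 \<Rightarrow> ennreal" where
  "major 0 = (\<lambda>t \<xi>. 0)"
| "major (Suc n) = (\<lambda>t \<xi>. ennreal (exp (- \<nu> * t * (norm \<xi>)\<^sup>2)) * norm (u0 \<xi>)
       + eduhamel \<nu> (\<lambda>s. econv (major n s) (major n s)) t \<xi>)"

text \<open>The same formula with the heat kernel replaced by its supremum 1 and the time integral
  extended to the half-line.\<close>

primrec envel :: "nat \<Rightarrow> real^3 \<Rightarrow> ennreal" where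
  "envel 0 = (\<lambda>\<xi>. 0)"
| "envel (Suc n) = (\<lambda>\<xi>. norm (u0 \<xi>) + ennreal (norm \<xi> / 6) *
       (\<integral>\<^sup>+ s. indicator {0..} s * econv (major n s) (major n s) \<xi> \<partial>lborel))"

lemma major_measurable [measurable]: "case_prod (major n) \<in> borel_measurable (borel \<Otimes>\<^sub>M borel)"
proof (induction n)
  case (Suc n)
  note Suc.IH [measurable]
  show ?case by (simp add: case_prod_beta')
qed simp

lemma envel_measurable [measurable]: "envel n \<in> borel_measurable borel"
  by (cases n) simp_all

lemma major_mono_Suc: "major n t \<xi> \<le> major (Suc n) t \<xi>"
proof (induction n arbitrary: t \<xi>)
  case (Suc n)
  have "eduhamel \<nu> (\<lambda>s. econv (major n s) (major n s)) t \<xi>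
     \<le> eduhamel \<nu> (\<lambda>s. econv (major (Suc n) s) (major (Suc n) s)) t \<xi>"
    by (intro eduhamel_mono econv_mono Suc.IH)
  then show ?case by (simp add: add_left_mono)
qed simp

lemma major_mono: "incseq (\<lambda>n. major n t \<xi>)"
  by (intro incseq_SucI major_mono_Suc)

lemma envel_mono: "incseq (\<lambda>n. envel n \<xi>)"
proof (rule incseq_SucI)
  show "envel n \<xi> \<le> envel (Suc n) \<xi>" for n
  proof (cases n)
    case (Suc m)
    show ?thesis unfolding Suc envel.simps
      by (intro add_left_mono mult_left_mono nn_integral_mono econv_mono major_mono_Suc) auto
  qed simp
qed

lemma major_le_envel: "t \<ge> 0 \<Longrightarrow> major n t \<xi> \<le> envel n \<xi>"
proof (cases n)
  case (Suc m)
  assume "t \<ge> 0"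
  then have "- \<nu> * t * (norm \<xi>)\<^sup>2 \<le> 0" using nu_pos by simp
  then have "ennreal (exp (- \<nu> * t * (norm \<xi>)\<^sup>2)) \<le> 1"
    by (subst ennreal_1[symmetric], intro ennreal_leI) simp
  from mult_right_mono[OF this, of "norm (u0 \<xi>)"]
  have "ennreal (exp (- \<nu> * t * (norm \<xi>)\<^sup>2)) * ennreal (norm (u0 \<xi>)) \<le> norm (u0 \<xi>)" by simp
  then show ?thesis unfolding Suc major.simps envel.simps
    by (intro add_mono eduhamel_le nu_pos) auto
qed simp

text \<open>The initial term and the forcing term both acquire the factor 1 / (\<nu> |\<xi>|^2), and
  what remains is \<open>envel n\<close>.\<close>

lemma nn_integral_major_le:
  assumes "\<xi> \<noteq> 0"
  shows "(\<integral>\<^sup>+ t. indicator {0..} t * major n t \<xi> \<partial>lborel) \<le> ennreal (1 / (\<nu> * (norm \<xi>)\<^sup>2)) * envel n \<xi>"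
proof (cases n)
  case (Suc m)
  have "(\<integral>\<^sup>+ t. indicator {0..} t * major n t \<xi> \<partial>lborel)
     = (\<integral>\<^sup>+ t. norm (u0 \<xi>) * (indicator {0..} t * ennreal (exp (- (\<nu> * (norm \<xi>)\<^sup>2) * (t - 0)))) +
         indicator {0..} t * eduhamel \<nu> (\<lambda>s. econv (major m s) (major m s)) t \<xi> \<partial>lborel)"
    unfolding Suc major.simps by (intro nn_integral_cong) (auto simp: distrib_left mult_ac)
  also have "\<dots> = norm (u0 \<xi>) * (\<integral>\<^sup>+ t. indicator {0..} t * ennreal (exp (- (\<nu> * (norm \<xi>)\<^sup>2) * (t - 0))) \<partial>lborel)
      + (\<integral>\<^sup>+ t. indicator {0..} t * eduhamel \<nu> (\<lambda>s. econv (major m s) (major m s)) t \<xi> \<partial>lborel)"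
    by (subst nn_integral_add) (auto simp: nn_integral_cmult)
  also have "(\<integral>\<^sup>+ t. indicator {0..} t * ennreal (exp (- (\<nu> * (norm \<xi>)\<^sup>2) * (t - 0))) \<partial>lborel)
      = ennreal (1 / (\<nu> * (norm \<xi>)\<^sup>2))"
    using assms nu_pos by (intro nn_integral_exp_decay) auto
  also have "(\<integral>\<^sup>+ t. indicator {0..} t * eduhamel \<nu> (\<lambda>s. econv (major m s) (major m s)) t \<xi> \<partial>lborel)
     = ennreal (1 / (\<nu> * (norm \<xi>)\<^sup>2)) * (ennreal (norm \<xi> / 6) *
        (\<integral>\<^sup>+ s. indicator {0..} s * econv (major m s) (major m s) \<xi> \<partial>lborel))"
    using assms nu_pos by (intro nn_integral_eduhamel) auto
  finally show ?thesis unfolding Suc envel.simps by (simp add: distrib_left mult.commute)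
qed simp

abbreviation "envel_mass n \<equiv> (\<integral>\<^sup>+ \<xi>. inverse (norm \<xi>) * (W \<xi> * envel n \<xi>) \<partial>lborel)"

text \<open>The quadratic recursion \<open>m \<mapsto> \<nu> + m\<^sup>2 / (6 \<nu>)\<close> leaves the interval below \<open>2 \<nu>\<close> invariant.\<close>

lemma envel_mass_le: "envel_mass n \<le> ennreal (2 * \<nu>)"
proof (induction n)
  case (Suc n)
  let ?Q = "\<lambda>\<xi>. \<integral>\<^sup>+ s. indicator {0..} s * econv (major n s) (major n s) \<xi> \<partial>lborel"
  \<comment> \<open>The weight 1 / |\<xi>| cancels the |\<xi>| of the nonlinearity, leaving exactly
    the quantity of \<open>weighted_econv_time_bound\<close>.\<close>
  have "envel_mass (Suc n) = (\<integral>\<^sup>+ \<xi>. inverse (norm \<xi>) * (W \<xi> * norm (u0 \<xi>)) + ennreal (1 / 6) * (W \<xi> * ?Q \<xi>) \<partial>lborel)"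
  proof (rule nn_integral_cong_AE, rule AE_mp[OF AE_lborel_neq0], rule AE_I2, rule impI)
    fix \<xi> :: "real^3" assume "\<xi> \<noteq> 0"
    then have "ennreal (inverse (norm \<xi>)) * ennreal (norm \<xi> / 6) = ennreal (1 / 6)"
      by (simp add: ennreal_mult[symmetric] field_simps)
    moreover have "ennreal (inverse (norm \<xi>)) * (W \<xi> * (ennreal (norm \<xi> / 6) * ?Q \<xi>))
      = (ennreal (inverse (norm \<xi>)) * ennreal (norm \<xi> / 6)) * (W \<xi> * ?Q \<xi>)"
      by (simp only: mult_ac)
    ultimately have "ennreal (inverse (norm \<xi>)) * (W \<xi> * (ennreal (norm \<xi> / 6) * ?Q \<xi>)) = ennreal (1 / 6) * (W \<xi> * ?Q \<xi>)"
      by simp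
    then show "inverse (norm \<xi>) * (W \<xi> * envel (Suc n) \<xi>)
      = inverse (norm \<xi>) * (W \<xi> * norm (u0 \<xi>)) + ennreal (1 / 6) * (W \<xi> * ?Q \<xi>)"
      by (simp add: distrib_left)
  qed
  also have "\<dots> = (\<integral>\<^sup>+ \<xi>. inverse (norm \<xi>) * (W \<xi> * norm (u0 \<xi>)) \<partial>lborel) + ennreal (1 / 6) * (\<integral>\<^sup>+ \<xi>. W \<xi> * ?Q \<xi> \<partial>lborel)"
    by (subst nn_integral_add) (auto simp: nn_integral_cmult)
  also have "\<dots> \<le> ennreal \<nu> + ennreal (1 / 6) * (ennreal (1 / \<nu>) * (envel_mass n)\<^sup>2)"
    by (intro add_mono u0_small mult_left_mono weighted_econv_time_bound W_submult nu_pos major_le_envel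
          nn_integral_major_le) auto
  also have "\<dots> \<le> ennreal \<nu> + ennreal (1 / 6) * (ennreal (1 / \<nu>) * (ennreal (2 * \<nu>))\<^sup>2)"
    by (intro add_left_mono mult_left_mono power_mono Suc.IH) auto
  also have "\<dots> = ennreal (\<nu> + 1 / 6 * (1 / \<nu> * (2 * \<nu>)\<^sup>2))"
    using nu_pos by (simp add: ennreal_power ennreal_mult[symmetric] ennreal_plus[symmetric] del: ennreal_plus)
  \<comment> \<open>The left side equals 5 \<nu> / 3.\<close>
  also have "\<dots> \<le> ennreal (2 * \<nu>)"
    using nu_pos by (intro ennreal_leI) (simp add: power2_eq_square field_simps)
  finally show ?case .
qed simp

definition major_lim :: "real \<Rightarrow> real^3 \<Rightarrow> ennreal" where "major_lim t \<xi> = (SUP n. major n t \<xi>)"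

definition envel_lim :: "real^3 \<Rightarrow> ennreal" where "envel_lim \<xi> = (SUP n. envel n \<xi>)"

lemma major_lim_measurable [measurable]: "case_prod major_lim \<in> borel_measurable (borel \<Otimes>\<^sub>M borel)"
  unfolding major_lim_def by measurable

lemma envel_lim_measurable [measurable]: "envel_lim \<in> borel_measurable borel"
  unfolding envel_lim_def[abs_def] by measurable

lemma major_le_major_lim: "major n t \<xi> \<le> major_lim t \<xi>"
  unfolding major_lim_def by (rule SUP_upper) simp

lemma major_lim_le: "t \<ge> 0 \<Longrightarrow> major_lim t \<xi> \<le> envel_lim \<xi>"
  unfolding major_lim_def envel_lim_def by (intro SUP_mono) (auto intro: major_le_envel)

lemma envel_lim_mass_le: "(\<integral>\<^sup>+ \<xi>. inverse (norm \<xi>) * (W \<xi> * envel_lim \<xi>) \<partial>lborel) \<le> ennreal (2 * \<nu>)"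
proof -
  have "(\<integral>\<^sup>+ \<xi>. inverse (norm \<xi>) * (W \<xi> * envel_lim \<xi>) \<partial>lborel) = (\<integral>\<^sup>+ \<xi>. (SUP n. inverse (norm \<xi>) * (W \<xi> * envel n \<xi>)) \<partial>lborel)"
    by (simp add: envel_lim_def SUP_mult_left_ennreal)
  also have "\<dots> = (SUP n. envel_mass n)"
    using envel_mono
    by (intro nn_integral_monotone_convergence_SUP)
       (auto simp: incseq_def le_fun_def intro!: mult_left_mono)
  also have "\<dots> \<le> ennreal (2 * \<nu>)" by (intro SUP_least envel_mass_le)
  finally show ?thesis .
qed

lemma nn_integral_major_lim_le:
  assumes "\<xi> \<noteq> 0"
  shows "(\<integral>\<^sup>+ t. indicator {0..} t * major_lim t \<xi> \<partial>lborel) \<le> ennreal (1 / (\<nu> * (norm \<xi>)\<^sup>2)) * envel_lim \<xi>"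
proof -
  have "(\<integral>\<^sup>+ t. indicator {0..} t * major_lim t \<xi> \<partial>lborel) = (\<integral>\<^sup>+ t. (SUP n. indicator {0..} t * major n t \<xi>) \<partial>lborel)"
    by (simp add: major_lim_def SUP_mult_left_ennreal)
  also have "\<dots> = (SUP n. \<integral>\<^sup>+ t. indicator {0..} t * major n t \<xi> \<partial>lborel)"
    using major_mono
    by (intro nn_integral_monotone_convergence_SUP)
       (auto simp: incseq_def le_fun_def intro!: mult_left_mono)
  also have "\<dots> \<le> (SUP n. ennreal (1 / (\<nu> * (norm \<xi>)\<^sup>2)) * envel n \<xi>)"
    by (intro SUP_mono) (auto intro: nn_integral_major_le[OF assms])
  finally show ?thesis by (simp add: envel_lim_def SUP_mult_left_ennreal)
qed

text \<open>Its finiteness at \<xi> makes the forcing integrable over all times there.\<close>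

definition flux :: "real^3 \<Rightarrow> ennreal" where
  "flux \<xi> = (\<integral>\<^sup>+ s. indicator {0..} s * econv (major_lim s) (major_lim s) \<xi> \<partial>lborel)"

lemma flux_measurable [measurable]: "flux \<in> borel_measurable borel"
  unfolding flux_def[abs_def] by measurable

text \<open>A set of full measure that does not depend on time: on it all Duhamel integrals below converge for every \<open>t\<close>.\<close>

definition good :: "(real^3) set" where "good = {\<xi>. \<xi> \<noteq> 0 \<and> envel_lim \<xi> < \<infinity> \<and> flux \<xi> < \<infinity>}"

lemma good_measurable [measurable]: "good \<in> sets borel"
  unfolding good_def by measurable

text \<open>The mass bound and the time bound for the limits give finite weighted integrals of
  \<open>envel_lim\<close> and \<open>flux\<close>, hence finite values almost everywhere.\<close>

lemma AE_good: "AE \<xi> in lborel. \<xi> \<in> good"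
proof -
  have "(\<integral>\<^sup>+ \<xi>. W \<xi> * flux \<xi> \<partial>lborel) \<le> ennreal (1 / \<nu>) * (\<integral>\<^sup>+ \<xi>. inverse (norm \<xi>) * (W \<xi> * envel_lim \<xi>) \<partial>lborel)\<^sup>2"
    unfolding flux_def
    by (intro weighted_econv_time_bound W_submult nu_pos major_lim_le nn_integral_major_lim_le) auto
  also have "\<dots> \<le> ennreal (1 / \<nu>) * (ennreal (2 * \<nu>))\<^sup>2"
    by (intro mult_left_mono power_mono envel_lim_mass_le) auto
  also have "\<dots> < \<infinity>" by (simp add: ennreal_power ennreal_mult[symmetric] ennreal_mult_less_top power_less_top_ennreal)
  finally have "AE \<xi> in lborel. W \<xi> * flux \<xi> \<noteq> \<infinity>" by (intro nn_integral_PInf_AE) auto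
  moreover have "AE \<xi> in lborel. inverse (norm \<xi>) * (W \<xi> * envel_lim \<xi>) \<noteq> \<infinity>"
    by (rule nn_integral_PInf_AE) (use envel_lim_mass_le in \<open>auto simp: top_unique\<close>)
  ultimately show ?thesis using AE_lborel_neq0
  proof eventually_elim
    case (elim \<xi>)
    \<comment> \<open>In \<open>ennreal\<close> 0 times infinity is 0, so a vanishing weight would
      hide an infinite factor.\<close>
    have nz: "W \<xi> \<noteq> 0" using W_ge_1[of \<xi>] by auto
    have "flux \<xi> \<noteq> \<infinity>" using elim(1) nz by (auto simp: ennreal_mult_top)
    moreover have "envel_lim \<xi> \<noteq> \<infinity>" using elim(2,3) nz by (auto simp: ennreal_mult_top)
    ultimately show ?case using elim(3) by (simp add: good_def less_top)
  qed
qed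

section \<open>Picard iteration\<close>

text \<open>The bound is the limit of the majorants rather than the n-th one, so that one condition
  covers every iterate and the solution.\<close>

definition dominated :: "(real \<Rightarrow> fvec) \<Rightarrow> bool" where
  "dominated v \<longleftrightarrow> case_prod v \<in> borel_measurable (borel \<Otimes>\<^sub>M borel) \<and>
     (\<forall>s\<ge>0. \<forall>\<eta>. ennreal (norm (v s \<eta>)) \<le> major_lim s \<eta>)"

lemma dominated_measurable [measurable_dest]:
  "dominated v \<Longrightarrow> case_prod v \<in> borel_measurable (borel \<Otimes>\<^sub>M borel)"
  by (simp add: dominated_def)

lemma dominated_econv_le:
  assumes "dominated v" "s \<ge> 0"
  shows "econv (\<lambda>\<eta>. norm (v s \<eta>)) (\<lambda>\<eta>. norm (v s \<eta>)) \<xi> \<le> econv (major_lim s) (major_lim s) \<xi>"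
  using assms by (intro econv_mono) (auto simp: dominated_def)

lemma AE_econv_major_lim_finite:
  assumes "\<xi> \<in> good"
  shows "AE s in lborel. 0 \<le> s \<longrightarrow> econv (major_lim s) (major_lim s) \<xi> < \<infinity>"
proof -
  have "AE s in lborel. indicator {0..} s * econv (major_lim s) (major_lim s) \<xi> \<noteq> \<infinity>"
    by (rule nn_integral_PInf_AE) (use assms in \<open>auto simp: good_def flux_def\<close>)
  then show ?thesis by eventually_elim (auto simp: less_top)
qed

lemma AE_econv_finite:
  assumes "\<xi> \<in> good" "dominated v"
  shows "AE s in lborel. 0 \<le> s \<longrightarrow> econv (\<lambda>\<eta>. norm (v s \<eta>)) (\<lambda>\<eta>. norm (v s \<eta>)) \<xi> < \<infinity>"
  using AE_econv_major_lim_finite[OF assms(1)]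
  by eventually_elim (use dominated_econv_le[OF assms(2)] in \<open>auto intro: le_less_trans\<close>)

text \<open>Stated without the heat factor and on the whole half-line: one integrable function
  independent of \<open>t\<close> then dominates all Duhamel integrands, also while \<open>t\<close>
  varies.\<close>

lemma forcing_integrable:
  assumes "\<xi> \<in> good" and v: "dominated v"
  shows "set_integrable lborel {0..} (\<lambda>s. leray \<xi> (nonlin (v s) \<xi>))"
  unfolding set_integrable_def
proof (rule integrableI_bounded)
  note [measurable] = dominated_measurable[OF v]
  show "(\<lambda>s. indicator {0..} s *\<^sub>R leray \<xi> (nonlin (v s) \<xi>)) \<in> borel_measurable lborel" by measurable
  have "(\<integral>\<^sup>+ s. ennreal (norm (indicator {0..} s *\<^sub>R leray \<xi> (nonlin (v s) \<xi>))) \<partial>lborel)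
      \<le> (\<integral>\<^sup>+ s. ennreal (norm \<xi> / 6) * (indicator {0..} s * econv (major_lim s) (major_lim s) \<xi>) \<partial>lborel)"
  proof (rule nn_integral_mono_AE, use AE_econv_finite[OF assms] in eventually_elim)
    case (elim s)
    show ?case
    proof (cases "0 \<le> s")
      case True
      have "ennreal (norm (leray \<xi> (nonlin (v s) \<xi>)))
          \<le> ennreal (norm \<xi> / 6) * econv (\<lambda>\<eta>. norm (v s \<eta>)) (\<lambda>\<eta>. norm (v s \<eta>)) \<xi>"
        using elim True by (intro norm_leray_nonlin_le) auto
      also have "\<dots> \<le> ennreal (norm \<xi> / 6) * econv (major_lim s) (major_lim s) \<xi>"
        by (intro mult_left_mono dominated_econv_le v True) auto
      finally show ?thesis using True by simp
    qed simp
  qed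
  also have "\<dots> = ennreal (norm \<xi> / 6) * flux \<xi>"
    unfolding flux_def by (rule nn_integral_cmult) measurable
  also have "\<dots> < \<infinity>" using assms(1) by (simp add: good_def ennreal_mult_less_top)
  finally show "(\<integral>\<^sup>+ s. ennreal (norm (indicator {0..} s *\<^sub>R leray \<xi> (nonlin (v s) \<xi>))) \<partial>lborel) < \<infinity>" .
qed

lemma norm_duhamel_integrand_le:
  assumes "s \<le> t"
  shows "norm (duhamel_integrand \<nu> v t \<xi> s) \<le> norm (leray \<xi> (nonlin (v s) \<xi>))"
proof -
  have "exp (- \<nu> * (t - s) * (norm \<xi>)\<^sup>2) \<le> 1" using assms nu_pos by simp
  from mult_right_mono[OF this, of "norm (leray \<xi> (nonlin (v s) \<xi>))"] show ?thesis
    by (simp add: duhamel_integrand_def)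
qed

lemma duhamel_integrable:
  assumes "\<xi> \<in> good" and v: "dominated v"
  shows "set_integrable lborel {0..t} (duhamel_integrand \<nu> v t \<xi>)"
  unfolding set_integrable_def
proof (rule Bochner_Integration.integrable_bound)
  note [measurable] = dominated_measurable[OF v]
  show "integrable lborel (\<lambda>s. indicator {0..} s *\<^sub>R leray \<xi> (nonlin (v s) \<xi>))"
    using forcing_integrable[OF assms] unfolding set_integrable_def .
  show "(\<lambda>s. indicator {0..t} s *\<^sub>R duhamel_integrand \<nu> v t \<xi> s) \<in> borel_measurable lborel" by measurable
  show "AE s in lborel. norm (indicator {0..t} s *\<^sub>R duhamel_integrand \<nu> v t \<xi> s)
      \<le> norm (indicator {0..} s *\<^sub>R leray \<xi> (nonlin (v s) \<xi>))"
    by (intro AE_I2) (auto split: split_indicator intro: norm_duhamel_integrand_le)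
qed

text \<open>The value 0 off \<open>good\<close> makes the bounds by \<open>major\<close> valid at
  every \<xi> instead of almost every one, and keeps divergent Duhamel integrals out.\<close>

primrec picard :: "nat \<Rightarrow> real \<Rightarrow> fvec" where
  "picard 0 = (\<lambda>t \<xi>. 0)"
| "picard (Suc n) = (\<lambda>t \<xi>. if 0 \<le> t \<and> \<xi> \<in> good
      then exp (- \<nu> * t * (norm \<xi>)\<^sup>2) *\<^sub>R u0 \<xi> - (LINT s:{0..t}|lborel. duhamel_integrand \<nu> (picard n) t \<xi> s)
      else 0)"

lemma picard_measurable [measurable]: "case_prod (picard n) \<in> borel_measurable (borel \<Otimes>\<^sub>M borel)"
proof (induction n)
  case (Suc n)
  note Suc.IH [measurable]
  show ?case unfolding picard.simps set_lebesgue_integral_def case_prod_beta' by measurable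
qed simp

lemma picard_outside: "\<xi> \<notin> good \<Longrightarrow> picard n t \<xi> = 0"
  by (cases n) simp_all

lemma dominated_picardI:
  "(\<And>t \<xi>. t \<ge> 0 \<Longrightarrow> ennreal (norm (picard n t \<xi>)) \<le> major n t \<xi>) \<Longrightarrow> dominated (picard n)"
  unfolding dominated_def by (meson major_le_major_lim order_trans picard_measurable)

declare picard.simps(2) [simp del] major.simps(2) [simp del]

text \<open>With increments d \<le> S' - S this is S' S' - S S = (S' - S) S' + S (S' - S) for
  convolutions, arranged additively to avoid subtraction in \<open>ennreal\<close>.\<close>

lemma econv_telescope:
  assumes [measurable]: "d \<in> borel_measurable borel" "S \<in> borel_measurable borel" "S' \<in> borel_measurable borel"
    and d: "\<And>\<eta>. d \<eta> + S \<eta> \<le> S' \<eta>" and v: "\<And>\<eta>. v' \<eta> \<le> S' \<eta>" "\<And>\<eta>. v \<eta> \<le> S \<eta>"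
  shows "(econv d v' \<xi> + econv v d \<xi>) + econv S S \<xi> \<le> econv S' S' \<xi>"
proof -
  have "(econv d v' \<xi> + econv v d \<xi>) + econv S S \<xi> \<le> econv d S' \<xi> + (econv S d \<xi> + econv S S \<xi>)"
    unfolding add.assoc by (intro add_mono econv_mono v) auto
  also have "\<dots> = econv d S' \<xi> + econv S (\<lambda>\<eta>. d \<eta> + S \<eta>) \<xi>"
    by (simp add: econv_add_right)
  also have "\<dots> \<le> econv d S' \<xi> + econv S S' \<xi>"
    by (intro add_left_mono econv_mono d) auto
  also have "\<dots> = econv (\<lambda>\<eta>. d \<eta> + S \<eta>) S' \<xi>"
    by (simp add: econv_add_left)
  also have "\<dots> \<le> econv S' S' \<xi>"
    by (intro econv_mono d) auto
  finally show ?thesis .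
qed

text \<open>Each increment of the vector iteration is bounded by that of the scalar one, again in
  additive form. The two claims go through one induction: the triangle inequality gives the size of
  the next iterate from the increment, and that size makes the Duhamel integrals converge, as the
  next increment requires.\<close>

lemma picard_bounds:
  assumes "t \<ge> 0"
  shows "ennreal (norm (picard n t \<xi>)) \<le> major n t \<xi>"
    and "ennreal (norm (picard (Suc n) t \<xi> - picard n t \<xi>)) + major n t \<xi> \<le> major (Suc n) t \<xi>"
proof -
  have "\<forall>t\<ge>0. \<forall>\<xi>. ennreal (norm (picard n t \<xi>)) \<le> major n t \<xi> \<and>
     ennreal (norm (picard (Suc n) t \<xi> - picard n t \<xi>)) + major n t \<xi> \<le> major (Suc n) t \<xi>"
  proof (induction n)
    case 0
    have "duhamel_integrand \<nu> (\<lambda>t \<xi>. 0) t \<xi> s = 0" for t \<xi> s by (simp add: duhamel_integrand_def)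
    then show ?case
      by (auto simp: picard.simps(2) major.simps(2) set_lebesgue_integral_def ennreal_mult)
  next
    case (Suc n)
    have bd: "ennreal (norm (picard (Suc n) t \<xi>)) \<le> major (Suc n) t \<xi>" if "t \<ge> 0" for t \<xi>
    proof -
      have "ennreal (norm (picard (Suc n) t \<xi>))
         \<le> ennreal (norm (picard (Suc n) t \<xi> - picard n t \<xi>)) + ennreal (norm (picard n t \<xi>))"
        using norm_triangle_sub[of "picard (Suc n) t \<xi>" "picard n t \<xi>"]
        by (simp add: ennreal_plus[symmetric] ennreal_leI add.commute del: ennreal_plus)
      also have "\<dots> \<le> ennreal (norm (picard (Suc n) t \<xi> - picard n t \<xi>)) + major n t \<xi>"
        using Suc.IH that by (intro add_left_mono) auto
      also have "\<dots> \<le> major (Suc n) t \<xi>" using Suc.IH that by auto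
      finally show ?thesis .
    qed
    have dom: "dominated (picard n)" "dominated (picard (Suc n))"
      using Suc.IH bd by (auto intro!: dominated_picardI)
    let ?d = "\<lambda>s \<eta>. ennreal (norm (picard (Suc n) s \<eta> - picard n s \<eta>))"
    let ?h = "\<lambda>s \<xi>. econv (?d s) (\<lambda>\<eta>. norm (picard (Suc n) s \<eta>)) \<xi> + econv (\<lambda>\<eta>. norm (picard n s \<eta>)) (?d s) \<xi>"
    have "ennreal (norm (picard (Suc (Suc n)) t \<xi> - picard (Suc n) t \<xi>)) + major (Suc n) t \<xi> \<le> major (Suc (Suc n)) t \<xi>"
      if t: "t \<ge> 0" for t \<xi>
    proof (cases "\<xi> \<in> good")
      case True
      have eq: "norm (picard (Suc (Suc n)) t \<xi> - picard (Suc n) t \<xi>)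
         = norm ((LINT s:{0..t}|lborel. duhamel_integrand \<nu> (picard (Suc n)) t \<xi> s)
               - (LINT s:{0..t}|lborel. duhamel_integrand \<nu> (picard n) t \<xi> s))"
        using True t unfolding picard.simps(2)[of "Suc n"]
        by (subst picard.simps(2)[of n]) (simp add: norm_minus_commute)
      have "ennreal (norm (picard (Suc (Suc n)) t \<xi> - picard (Suc n) t \<xi>)) \<le> eduhamel \<nu> ?h t \<xi>"
        unfolding eq
      proof (rule norm_duhamel_integral_diff_le)
        show "AE s in lborel. 0 \<le> s \<and> s \<le> t \<longrightarrow>
          econv (\<lambda>\<eta>. norm (picard (Suc n) s \<eta>)) (\<lambda>\<eta>. norm (picard (Suc n) s \<eta>)) \<xi> < \<infinity> \<and>
          econv (\<lambda>\<eta>. norm (picard n s \<eta>)) (\<lambda>\<eta>. norm (picard n s \<eta>)) \<xi> < \<infinity>"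
          using AE_econv_finite[OF True dom(1)] AE_econv_finite[OF True dom(2)] by eventually_elim auto
      qed (use True dom in \<open>auto intro: duhamel_integrable\<close>)
      then have "ennreal (norm (picard (Suc (Suc n)) t \<xi> - picard (Suc n) t \<xi>)) + major (Suc n) t \<xi>
         \<le> eduhamel \<nu> ?h t \<xi> + (ennreal (exp (- \<nu> * t * (norm \<xi>)\<^sup>2)) * norm (u0 \<xi>)
             + eduhamel \<nu> (\<lambda>s. econv (major n s) (major n s)) t \<xi>)"
        unfolding major.simps(2)[of n] by (rule add_right_mono)
      also have "\<dots> = ennreal (exp (- \<nu> * t * (norm \<xi>)\<^sup>2)) * norm (u0 \<xi>)
             + eduhamel \<nu> (\<lambda>s \<xi>. ?h s \<xi> + econv (major n s) (major n s) \<xi>) t \<xi>"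
        by (subst eduhamel_add) (auto simp: add_ac)
      also have "\<dots> \<le> major (Suc (Suc n)) t \<xi>"
        unfolding major.simps(2)[of "Suc n"]
        using Suc.IH bd by (intro add_left_mono eduhamel_mono econv_telescope) auto
      finally show ?thesis .
    qed (simp add: picard_outside major_mono_Suc)
    with bd show ?case by blast
  qed
  with assms show "ennreal (norm (picard n t \<xi>)) \<le> major n t \<xi>"
    and "ennreal (norm (picard (Suc n) t \<xi> - picard n t \<xi>)) + major n t \<xi> \<le> major (Suc n) t \<xi>" by blast+
qed

lemma dominated_picard: "dominated (picard n)"
  by (intro dominated_picardI picard_bounds)

text \<open>On \<open>good\<close> the increments sum to at most the finite value
  \<open>major_lim t \<xi>\<close>, so the telescoping series converges absolutely; elsewhere the
  sequence is constantly 0.\<close>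

lemma picard_convergent:
  assumes "t \<ge> 0"
  shows "convergent (\<lambda>n. picard n t \<xi>)"
proof (cases "\<xi> \<in> good")
  case True
  let ?d = "\<lambda>n. picard (Suc n) t \<xi> - picard n t \<xi>"
  have partial: "ennreal (\<Sum>k<n. norm (?d k)) \<le> major n t \<xi>" for n
  proof (induction n)
    case (Suc n)
    have "ennreal (\<Sum>k<Suc n. norm (?d k)) = ennreal (norm (?d n)) + ennreal (\<Sum>k<n. norm (?d k))"
      by (simp add: ennreal_plus[symmetric] sum_nonneg add.commute del: ennreal_plus)
    also have "\<dots> \<le> ennreal (norm (?d n)) + major n t \<xi>" by (intro add_left_mono Suc.IH)
    also have "\<dots> \<le> major (Suc n) t \<xi>" by (rule picard_bounds[OF assms])
    finally show ?case .
  qed simp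
  have "major_lim t \<xi> < \<infinity>"
    using True major_lim_le[OF assms, of \<xi>] by (auto simp: good_def intro: le_less_trans)
  then obtain c where c: "major_lim t \<xi> = ennreal c" "c \<ge> 0" by (cases "major_lim t \<xi>") auto
  have "(\<Sum>k<n. norm (?d k)) \<le> c" for n
    using order_trans[OF partial[of n] major_le_major_lim[of n t \<xi>]] c by simp
  then have "summable (\<lambda>k. norm (?d k))" by (intro summableI_nonneg_bounded[of _ c]) auto
  then have "summable ?d" by (rule summable_norm_cancel)
  then have "(\<lambda>n. \<Sum>k<n. ?d k) \<longlonglongrightarrow> suminf ?d" by (rule summable_LIMSEQ)
  \<comment> \<open>The partial sums telescope to \<open>picard n t \<xi>\<close> itself, as the
    iteration starts at 0.\<close>
  then have "(\<lambda>n. picard n t \<xi>) \<longlonglongrightarrow> suminf ?d"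
    unfolding sum_lessThan_telescope[of "\<lambda>n. picard n t \<xi>"] by simp
  then show ?thesis by (rule convergentI)
qed (simp add: picard_outside convergent_const)

section \<open>The limit of the iteration and its Duhamel equation\<close>

definition sol :: "real \<Rightarrow> fvec" where "sol t \<xi> = (if t \<ge> 0 then lim (\<lambda>n. picard n t \<xi>) else 0)"

lemma sol_measurable [measurable]: "case_prod sol \<in> borel_measurable (borel \<Otimes>\<^sub>M borel)"
  unfolding sol_def by measurable

lemma picard_tendsto_sol: "t \<ge> 0 \<Longrightarrow> (\<lambda>n. picard n t \<xi>) \<longlonglongrightarrow> sol t \<xi>"
  using picard_convergent[of t \<xi>] by (simp add: sol_def convergent_LIMSEQ_iff)

lemma norm_sol_le: "t \<ge> 0 \<Longrightarrow> ennreal (norm (sol t \<xi>)) \<le> major_lim t \<xi>"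
proof -
  assume t: "t \<ge> 0"
  have "(\<lambda>n. ennreal (norm (picard n t \<xi>))) \<longlonglongrightarrow> ennreal (norm (sol t \<xi>))"
    by (intro tendsto_ennrealI tendsto_norm picard_tendsto_sol t)
  then show ?thesis
    by (rule LIMSEQ_le_const2) (use t in \<open>auto intro: order_trans[OF picard_bounds(1) major_le_major_lim]\<close>)
qed

lemma dominated_sol: "dominated sol"
  unfolding dominated_def using norm_sol_le by auto

lemma picard_diff_le:
  assumes "s \<ge> 0"
  shows "ennreal (norm (picard n s \<eta> - sol s \<eta>)) \<le> 2 * major_lim s \<eta>"
proof -
  have "ennreal (norm (picard n s \<eta> - sol s \<eta>)) \<le> ennreal (norm (picard n s \<eta>)) + ennreal (norm (sol s \<eta>))"
    by (simp add: ennreal_plus[symmetric] ennreal_leI norm_triangle_ineq4 del: ennreal_plus)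
  also have "\<dots> \<le> major_lim s \<eta> + major_lim s \<eta>"
    using dominated_picard dominated_sol assms by (intro add_mono) (auto simp: dominated_def)
  finally show ?thesis by (simp add: mult_2)
qed

lemma picard_diff_tendsto_0:
  assumes "s \<ge> 0"
  shows "(\<lambda>n. ennreal (norm (picard n s \<eta> - sol s \<eta>))) \<longlonglongrightarrow> 0"
  using picard_tendsto_sol[OF assms, of \<eta>]
  by (subst ennreal_tendsto_0_iff) (auto intro: tendsto_norm_zero LIM_zero)

lemma econv_picard_diff_tendsto_0:
  assumes s: "s \<ge> 0" and fin: "econv (major_lim s) (major_lim s) \<xi> < \<infinity>"
  shows "(\<lambda>n. econv (\<lambda>\<eta>. norm (picard n s \<eta> - sol s \<eta>)) (major_lim s) \<xi>) \<longlonglongrightarrow> 0"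
proof -
  have "(\<lambda>n. econv (\<lambda>\<eta>. norm (picard n s \<eta> - sol s \<eta>)) (major_lim s) \<xi>) \<longlonglongrightarrow> (\<integral>\<^sup>+ (\<eta>::real^3). 0 \<partial>lborel)"
    unfolding econv_def
  proof (rule nn_integral_dominated_convergence[where w="\<lambda>\<eta>. 2 * (major_lim s (\<xi> - \<eta>) * major_lim s \<eta>)"])
    show "AE \<eta> in lborel. ennreal (norm (picard n s (\<xi> - \<eta>) - sol s (\<xi> - \<eta>))) * major_lim s \<eta>
        \<le> 2 * (major_lim s (\<xi> - \<eta>) * major_lim s \<eta>)" for n
      unfolding mult.assoc[symmetric] by (intro AE_I2 mult_right_mono picard_diff_le s) auto
    show "(\<integral>\<^sup>+ \<eta>. 2 * (major_lim s (\<xi> - \<eta>) * major_lim s \<eta>) \<partial>lborel) < \<infinity>"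
      using fin unfolding econv_def by (subst nn_integral_cmult) (auto simp: ennreal_mult_less_top)
    \<comment> \<open>Multiplication by infinity is not continuous at 0, so the constant factor must
      be finite. It is for \<eta> in \<open>good\<close>, whereas the other factor converges at
      every point.\<close>
    show "AE \<eta> in lborel. (\<lambda>n. ennreal (norm (picard n s (\<xi> - \<eta>) - sol s (\<xi> - \<eta>))) * major_lim s \<eta>) \<longlonglongrightarrow> 0"
      using AE_good
    proof eventually_elim
      case (elim \<eta>)
      then have "major_lim s \<eta> < top"
        using major_lim_le[OF s, of \<eta>] by (auto simp: good_def intro: le_less_trans)
      from ennreal_tendsto_cmult[OF this picard_diff_tendsto_0[OF s, of "\<xi> - \<eta>"]]
      show ?case by (simp add: mult.commute)
    qed
  qed measurable
  then show ?thesis by simp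
qed

text \<open>Two nested dominated convergences: in \<eta> at a fixed time by the preceding lemma,
  then in time, where the finite \<open>flux\<close> supplies the integrable bound.\<close>

lemma duhamel_picard_tendsto:
  assumes good: "\<xi> \<in> good"
  shows "(\<lambda>n. LINT s:{0..t}|lborel. duhamel_integrand \<nu> (picard n) t \<xi> s)
     \<longlonglongrightarrow> (LINT s:{0..t}|lborel. duhamel_integrand \<nu> sol t \<xi> s)"
proof -
  let ?d = "\<lambda>n s \<eta>. ennreal (norm (picard n s \<eta> - sol s \<eta>))"
  let ?h = "\<lambda>n s \<xi>. econv (?d n s) (\<lambda>\<eta>. norm (picard n s \<eta>)) \<xi> + econv (\<lambda>\<eta>. norm (sol s \<eta>)) (?d n s) \<xi>"
  have h_le: "?h n s \<xi> \<le> 2 * econv (?d n s) (major_lim s) \<xi>" if "s \<ge> 0" for n s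
  proof -
    have "?h n s \<xi> \<le> econv (?d n s) (major_lim s) \<xi> + econv (major_lim s) (?d n s) \<xi>"
      using dominated_picard[of n] dominated_sol that
      by (intro add_mono econv_mono) (auto simp: dominated_def)
    also have "econv (major_lim s) (?d n s) \<xi> = econv (?d n s) (major_lim s) \<xi>"
      by (rule econv_commute) measurable
    finally show ?thesis by (simp add: mult_2)
  qed
  \<comment> \<open>One factor 2 comes from the two symmetric convolutions, the other from
    \<open>picard_diff_le\<close>.\<close>
  have h_le': "?h n s \<xi> \<le> 4 * econv (major_lim s) (major_lim s) \<xi>" if "s \<ge> 0" for n s
  proof -
    have "econv (?d n s) (major_lim s) \<xi> \<le> econv (\<lambda>\<eta>. 2 * major_lim s \<eta>) (major_lim s) \<xi>"
      by (intro econv_mono picard_diff_le that) auto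
    also have "\<dots> = 2 * econv (major_lim s) (major_lim s) \<xi>"
      unfolding econv_def by (subst nn_integral_cmult[symmetric]) (auto simp: mult.assoc)
    finally have "2 * econv (?d n s) (major_lim s) \<xi> \<le> 2 * (2 * econv (major_lim s) (major_lim s) \<xi>)"
      by (intro mult_left_mono) auto
    with h_le[OF that, of n] show ?thesis by (auto simp: mult.assoc[symmetric] intro: order_trans)
  qed
  have "(\<lambda>n. eduhamel \<nu> (?h n) t \<xi>) \<longlonglongrightarrow> (\<integral>\<^sup>+ (s::real). 0 \<partial>lborel)"
    unfolding eduhamel_def
  proof (rule nn_integral_dominated_convergence[where
        w="\<lambda>s. (ennreal (norm \<xi> / 6) * 4) * (indicator {0..} s * econv (major_lim s) (major_lim s) \<xi>)"])
    show "AE s in lborel. indicator {0..t} s * (ennreal (exp (- \<nu> * (t - s) * (norm \<xi>)\<^sup>2)) * (ennreal (norm \<xi> / 6) * ?h n s \<xi>))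
       \<le> (ennreal (norm \<xi> / 6) * 4) * (indicator {0..} s * econv (major_lim s) (major_lim s) \<xi>)" for n
    proof (rule AE_I2)
      fix s
      show "indicator {0..t} s * (ennreal (exp (- \<nu> * (t - s) * (norm \<xi>)\<^sup>2)) * (ennreal (norm \<xi> / 6) * ?h n s \<xi>))
       \<le> (ennreal (norm \<xi> / 6) * 4) * (indicator {0..} s * econv (major_lim s) (major_lim s) \<xi>)"
      proof (cases "0 \<le> s \<and> s \<le> t")
        case True
        then have "exp (- \<nu> * (t - s) * (norm \<xi>)\<^sup>2) \<le> 1" using nu_pos by simp
        then have "ennreal (exp (- \<nu> * (t - s) * (norm \<xi>)\<^sup>2)) \<le> 1"
          by (subst ennreal_1[symmetric], intro ennreal_leI)
        then have "ennreal (exp (- \<nu> * (t - s) * (norm \<xi>)\<^sup>2)) * (ennreal (norm \<xi> / 6) * ?h n s \<xi>)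
           \<le> 1 * (ennreal (norm \<xi> / 6) * (4 * econv (major_lim s) (major_lim s) \<xi>))"
          using True by (intro mult_mono h_le') auto
        then show ?thesis using True by (simp add: mult.assoc)
      qed (auto split: split_indicator)
    qed
    have "(\<integral>\<^sup>+ s. (ennreal (norm \<xi> / 6) * 4) * (indicator {0..} s * econv (major_lim s) (major_lim s) \<xi>) \<partial>lborel)
       = (ennreal (norm \<xi> / 6) * 4) * flux \<xi>"
      unfolding flux_def by (rule nn_integral_cmult) measurable
    also have "\<dots> < \<infinity>" using good by (auto simp: good_def ennreal_mult_less_top)
    finally show "(\<integral>\<^sup>+ s. (ennreal (norm \<xi> / 6) * 4) * (indicator {0..} s * econv (major_lim s) (major_lim s) \<xi>) \<partial>lborel) < \<infinity>" .
    show "AE s in lborel. (\<lambda>n. indicator {0..t} s * (ennreal (exp (- \<nu> * (t - s) * (norm \<xi>)\<^sup>2)) * (ennreal (norm \<xi> / 6) * ?h n s \<xi>))) \<longlonglongrightarrow> 0"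
      using AE_econv_major_lim_finite[OF good]
    proof eventually_elim
      case (elim s)
      show ?case
      proof (cases "0 \<le> s \<and> s \<le> t")
        case True
        have "(\<lambda>n. 2 * econv (?d n s) (major_lim s) \<xi>) \<longlonglongrightarrow> 2 * 0"
          using True elim by (intro ennreal_tendsto_cmult econv_picard_diff_tendsto_0) auto
        then have "(\<lambda>n. ?h n s \<xi>) \<longlonglongrightarrow> 0"
          using h_le True by (intro tendsto_sandwich[of "\<lambda>_. 0" "\<lambda>n. ?h n s \<xi>" sequentially "\<lambda>n. 2 * econv (?d n s) (major_lim s) \<xi>"]) auto
        then have "(\<lambda>n. ennreal (exp (- \<nu> * (t - s) * (norm \<xi>)\<^sup>2)) * (ennreal (norm \<xi> / 6) * ?h n s \<xi>))
           \<longlonglongrightarrow> ennreal (exp (- \<nu> * (t - s) * (norm \<xi>)\<^sup>2)) * (ennreal (norm \<xi> / 6) * 0)"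
          by (intro ennreal_tendsto_cmult) auto
        then show ?thesis using True by simp
      qed (auto split: split_indicator)
    qed
  qed measurable
  then have lim0: "(\<lambda>n. eduhamel \<nu> (?h n) t \<xi>) \<longlonglongrightarrow> 0" by simp
  have "(\<lambda>n. ennreal (norm ((LINT s:{0..t}|lborel. duhamel_integrand \<nu> (picard n) t \<xi> s)
         - (LINT s:{0..t}|lborel. duhamel_integrand \<nu> sol t \<xi> s)))) \<longlonglongrightarrow> 0"
  proof (rule tendsto_sandwich[OF _ _ tendsto_const lim0])
    have "ennreal (norm ((LINT s:{0..t}|lborel. duhamel_integrand \<nu> (picard n) t \<xi> s)
         - (LINT s:{0..t}|lborel. duhamel_integrand \<nu> sol t \<xi> s))) \<le> eduhamel \<nu> (?h n) t \<xi>" for n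
    proof (rule norm_duhamel_integral_diff_le)
      show "AE s in lborel. 0 \<le> s \<and> s \<le> t \<longrightarrow>
          econv (\<lambda>\<eta>. norm (picard n s \<eta>)) (\<lambda>\<eta>. norm (picard n s \<eta>)) \<xi> < \<infinity> \<and>
          econv (\<lambda>\<eta>. norm (sol s \<eta>)) (\<lambda>\<eta>. norm (sol s \<eta>)) \<xi> < \<infinity>"
        using AE_econv_finite[OF good dominated_picard[of n]] AE_econv_finite[OF good dominated_sol]
        by eventually_elim auto
    qed (use good in \<open>auto intro!: duhamel_integrable dominated_picard dominated_sol\<close>)
    then show "\<forall>\<^sub>F n in sequentially. ennreal (norm ((LINT s:{0..t}|lborel. duhamel_integrand \<nu> (picard n) t \<xi> s)
         - (LINT s:{0..t}|lborel. duhamel_integrand \<nu> sol t \<xi> s))) \<le> eduhamel \<nu> (?h n) t \<xi>" by simp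
  qed simp
  then show ?thesis
    by (subst (asm) ennreal_tendsto_0_iff) (auto intro: LIM_zero_cancel dest: tendsto_norm_zero_cancel)
qed

lemma sol_duhamel:
  assumes good: "\<xi> \<in> good" and t: "t \<ge> 0"
  shows "sol t \<xi> = exp (- \<nu> * t * (norm \<xi>)\<^sup>2) *\<^sub>R u0 \<xi> - (LINT s:{0..t}|lborel. duhamel_integrand \<nu> sol t \<xi> s)"
proof (rule LIMSEQ_unique)
  show "(\<lambda>n. picard (Suc n) t \<xi>) \<longlonglongrightarrow> sol t \<xi>"
    using picard_tendsto_sol[OF t] by (rule LIMSEQ_Suc)
  show "(\<lambda>n. picard (Suc n) t \<xi>) \<longlonglongrightarrow>
      exp (- \<nu> * t * (norm \<xi>)\<^sup>2) *\<^sub>R u0 \<xi> - (LINT s:{0..t}|lborel. duhamel_integrand \<nu> sol t \<xi> s)"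
    using good t unfolding picard.simps(2) by (simp, intro tendsto_intros duhamel_picard_tendsto)
qed

lemma sol_NSE_mild: "NSE_mild \<nu> u0 sol"
  unfolding NSE_mild_def
proof (intro allI impI)
  fix t :: real assume t: "0 \<le> t"
  show "AE \<xi> in lborel. set_integrable lborel {0..t} (duhamel_integrand \<nu> sol t \<xi>) \<and>
      sol t \<xi> = exp (- \<nu> * t * (norm \<xi>)\<^sup>2) *\<^sub>R u0 \<xi> - (LINT s:{0..t}|lborel. duhamel_integrand \<nu> sol t \<xi> s)"
    using AE_good by eventually_elim (intro conjI sol_duhamel duhamel_integrable dominated_sol t)
qed

section \<open>Continuity in time, divergence and reality\<close>

text \<open>With the interval written as an indicator, the moving endpoint and the moving heat
  factor are treated together by dominated convergence.\<close>

lemma sol_continuous_pointwise: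
  assumes good: "\<xi> \<in> good" and X: "X \<longlonglongrightarrow> t" "\<And>i. X i \<ge> 0" "t \<ge> 0"
  shows "(\<lambda>i. sol (X i) \<xi>) \<longlonglongrightarrow> sol t \<xi>"
proof -
  have "(\<lambda>i. LINT s|lborel. indicator {0..X i} s *\<^sub>R duhamel_integrand \<nu> sol (X i) \<xi> s)
     \<longlonglongrightarrow> (LINT s|lborel. indicator {0..t} s *\<^sub>R duhamel_integrand \<nu> sol t \<xi> s)"
  proof (rule integral_dominated_convergence[where w="\<lambda>s. norm (indicator {0..} s *\<^sub>R leray \<xi> (nonlin (sol s) \<xi>))"])
    show "integrable lborel (\<lambda>s. norm (indicator {0..} s *\<^sub>R leray \<xi> (nonlin (sol s) \<xi>)))"
      using forcing_integrable[OF good dominated_sol] unfolding set_integrable_def by (rule integrable_norm)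
    show "AE s in lborel. norm (indicator {0..X i} s *\<^sub>R duhamel_integrand \<nu> sol (X i) \<xi> s)
        \<le> norm (indicator {0..} s *\<^sub>R leray \<xi> (nonlin (sol s) \<xi>))" for i
      by (intro AE_I2) (auto split: split_indicator intro: norm_duhamel_integrand_le)
    show "AE s in lborel. (\<lambda>i. indicator {0..X i} s *\<^sub>R duhamel_integrand \<nu> sol (X i) \<xi> s)
        \<longlonglongrightarrow> indicator {0..t} s *\<^sub>R duhamel_integrand \<nu> sol t \<xi> s"
      \<comment> \<open>At s = t the indicators may oscillate along the sequence; this single point
        is discarded.\<close>
      using AE_lborel_singleton[of t]
    proof eventually_elim
      case (elim s)
      have "\<forall>\<^sub>F i in sequentially. indicator {0..X i} s = (indicator {0..t} s :: real)"
      proof (cases "s < t")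
        case True
        from order_tendstoD(1)[OF X(1) True] show ?thesis
          by eventually_elim (use True in \<open>auto split: split_indicator\<close>)
      next
        case False
        with elim have "t < s" by simp
        from order_tendstoD(2)[OF X(1) this] show ?thesis
          by eventually_elim (use \<open>t < s\<close> in \<open>auto split: split_indicator\<close>)
      qed
      then have "(\<lambda>i. indicator {0..X i} s :: real) \<longlonglongrightarrow> indicator {0..t} s"
        by (rule tendsto_eventually)
      then show ?case
        unfolding duhamel_integrand_def by (intro tendsto_intros X)
    qed
  qed measurable
  then have "(\<lambda>i. exp (- \<nu> * X i * (norm \<xi>)\<^sup>2) *\<^sub>R u0 \<xi> - (LINT s:{0..X i}|lborel. duhamel_integrand \<nu> sol (X i) \<xi> s))
     \<longlonglongrightarrow> exp (- \<nu> * t * (norm \<xi>)\<^sup>2) *\<^sub>R u0 \<xi> - (LINT s:{0..t}|lborel. duhamel_integrand \<nu> sol t \<xi> s)"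
    unfolding set_lebesgue_integral_def by (intro tendsto_intros X)
  then show ?thesis
    using sol_duhamel[OF good] X by simp
qed

text \<open>The functional v \<mapsto> \<xi> . v commutes with the Duhamel integral and annihilates
  the projected integrand, as \<xi> \<noteq> 0 on \<open>good\<close>; only the multiple of
  \<open>u0\<close> survives.\<close>

lemma sol_div_free:
  assumes "div_free u0" "t \<ge> 0"
  shows "div_free (sol t)"
  unfolding div_free_def
  using AE_good assms(1)[unfolded div_free_def]
proof eventually_elim
  case (elim \<xi>)
  define T where "T v = (\<Sum>j\<in>UNIV. complex_of_real (\<xi> $ j) * v $ j)" for v :: "complex^3"
  have T: "bounded_linear T"
    unfolding T_def
    by (intro bounded_linear_sum bounded_linear_compose[OF bounded_linear_mult_right] bounded_linear_vec_nth)
  have zero: "T (duhamel_integrand \<nu> sol t \<xi> s) = 0" for s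
    using elim(1) dot_leray[of \<xi> "nonlin (sol s) \<xi>"]
    unfolding duhamel_integrand_def linear_scale[OF bounded_linear.linear[OF T]]
    by (simp add: T_def good_def)
  have "T (LINT s:{0..t}|lborel. duhamel_integrand \<nu> sol t \<xi> s)
      = (LINT s|lborel. T (indicator {0..t} s *\<^sub>R duhamel_integrand \<nu> sol t \<xi> s))"
    using duhamel_integrable[OF elim(1) dominated_sol, of t] unfolding set_integrable_def set_lebesgue_integral_def
    by (rule integral_bounded_linear[OF T, symmetric])
  also have "\<dots> = 0" by (simp add: linear_scale[OF bounded_linear.linear[OF T]] zero)
  finally have "T (sol t \<xi>) = exp (- \<nu> * t * (norm \<xi>)\<^sup>2) *\<^sub>R T (u0 \<xi>)"
    unfolding sol_duhamel[OF elim(1) assms(2)] linear_diff[OF bounded_linear.linear[OF T]]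
      linear_scale[OF bounded_linear.linear[OF T]] by simp
  then show ?case using elim(2) by (simp add: T_def)
qed

text \<open>Symmetry of a Duhamel integrand presupposes that of the velocity inside it, so it is
  propagated along the iterates and passed to the limit afterwards.\<close>

lemma picard_real_field:
  assumes u0: "real_field u0"
  shows "t \<ge> 0 \<Longrightarrow> real_field (picard n t)"
proof (induction n arbitrary: t)
  case 0
  then show ?case by (simp add: real_field_def vec_eq_iff)
next
  case (Suc n)
  \<comment> \<open>The iterate at -\<xi> is given by the Duhamel formula only if -\<xi> also lies
    in \<open>good\<close>, which holds for almost every \<xi>.\<close>
  have "AE \<xi> in lborel. 0 - \<xi> \<in> good" by (rule AE_lborel_reflect[OF AE_good])
  with AE_good u0[unfolded real_field_def vcnj_def[symmetric]]
  show ?case unfolding real_field_def vcnj_def[symmetric]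
  proof eventually_elim
    case (elim \<xi>)
    note lin = bounded_linear.linear[OF bounded_linear_vcnj]
    have "duhamel_integrand \<nu> (picard n) t (- \<xi>) s = vcnj (duhamel_integrand \<nu> (picard n) t \<xi> s)" if "s \<ge> 0" for s
      using nonlin_uminus[OF _ Suc.IH[OF that], of \<xi>]
      by (simp add: duhamel_integrand_def leray_uminus_vcnj linear_scale[OF lin])
    then have "(LINT s:{0..t}|lborel. duhamel_integrand \<nu> (picard n) t (- \<xi>) s)
       = (LINT s|lborel. vcnj (indicator {0..t} s *\<^sub>R duhamel_integrand \<nu> (picard n) t \<xi> s))"
      unfolding set_lebesgue_integral_def
      by (intro Bochner_Integration.integral_cong)
         (auto split: split_indicator simp: linear_0[OF lin])
    also have "\<dots> = vcnj (LINT s:{0..t}|lborel. duhamel_integrand \<nu> (picard n) t \<xi> s)"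
      using duhamel_integrable[OF elim(1) dominated_picard, of t n] unfolding set_integrable_def set_lebesgue_integral_def
      by (rule integral_bounded_linear[OF bounded_linear_vcnj])
    finally show ?case
      using elim Suc.prems by (simp add: picard.simps(2) linear_diff[OF lin] linear_scale[OF lin])
  qed
qed

lemma sol_real_field:
  assumes "real_field u0" "t \<ge> 0"
  shows "real_field (sol t)"
proof -
  have "AE \<xi> in lborel. \<forall>n. picard n t (- \<xi>) = vcnj (picard n t \<xi>)"
    using picard_real_field[OF assms] unfolding real_field_def vcnj_def[symmetric]
    by (simp add: AE_all_countable)
  then show ?thesis
    unfolding real_field_def vcnj_def[symmetric]
  proof eventually_elim
    case (elim \<xi>)
    have "(\<lambda>n. vcnj (picard n t \<xi>)) \<longlonglongrightarrow> vcnj (sol t \<xi>)"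
      by (rule bounded_linear.tendsto[OF bounded_linear_vcnj picard_tendsto_sol[OF assms(2)]])
    moreover have "(\<lambda>n. picard n t (- \<xi>)) \<longlonglongrightarrow> sol t (- \<xi>)" by (rule picard_tendsto_sol[OF assms(2)])
    ultimately show ?case using elim by (simp add: LIMSEQ_unique)
  qed
qed

text \<open>The finite Gevrey-weighted integral of \<open>envel_lim\<close> yields the bound at each
  time, the dominating function for continuity and, through the time integral of
  \<open>major_lim\<close>, integrability in \<open>Z_norm 1\<close>.\<close>

lemma sol_sol_class:
  assumes w: "\<And>\<xi>. ennreal (exp (a * norm \<xi> powr (1 / \<sigma>))) \<le> ennreal C * W \<xi>"
    and u0: "div_free u0" "real_field u0"
  shows "sol_class a \<sigma> sol"
proof -
  let ?w = "\<lambda>\<xi>::real^3. ennreal (exp (a * norm \<xi> powr (1 / \<sigma>)))"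
  have envel: "(\<integral>\<^sup>+ \<xi>. inverse (norm \<xi>) * (?w \<xi> * envel_lim \<xi>) \<partial>lborel) < \<infinity>"
  proof -
    have "(\<integral>\<^sup>+ \<xi>. inverse (norm \<xi>) * (?w \<xi> * envel_lim \<xi>) \<partial>lborel)
       \<le> (\<integral>\<^sup>+ \<xi>. inverse (norm \<xi>) * ((ennreal C * W \<xi>) * envel_lim \<xi>) \<partial>lborel)"
      by (intro nn_integral_mono mult_left_mono mult_right_mono w) auto
    also have "\<dots> = (\<integral>\<^sup>+ \<xi>. ennreal C * (inverse (norm \<xi>) * (W \<xi> * envel_lim \<xi>)) \<partial>lborel)"
      by (simp add: mult_ac)
    also have "\<dots> = ennreal C * (\<integral>\<^sup>+ \<xi>. inverse (norm \<xi>) * (W \<xi> * envel_lim \<xi>) \<partial>lborel)"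
      by (rule nn_integral_cmult) measurable
    also have "\<dots> < \<infinity>"
      using envel_lim_mass_le by (auto simp: ennreal_mult_less_top intro: le_less_trans)
    finally show ?thesis .
  qed
  have norm_le: "ennreal (norm (sol t \<xi>)) \<le> envel_lim \<xi>" if "t \<ge> 0" for t \<xi>
    using norm_sol_le[OF that] major_lim_le[OF that] by (rule order_trans)
  have "(\<lambda>p. if fst p \<ge> 0 then sol (fst p) (snd p) else 0) \<in> borel_measurable (lborel \<Otimes>\<^sub>M lborel)"
    by measurable
  moreover have "in_Z (-1) a \<sigma> (sol t)" if t: "t \<ge> 0" for t
  proof -
    have "Z_norm (-1) a \<sigma> (sol t) \<le> (\<integral>\<^sup>+ \<xi>. inverse (norm \<xi>) * (?w \<xi> * envel_lim \<xi>) \<partial>lborel)"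
      unfolding Z_norm_minus1_eq by (intro nn_integral_mono mult_left_mono norm_le t) auto
    with envel show ?thesis by (auto simp: in_Z_def intro: le_less_trans)
  qed
  moreover have "((\<lambda>t. Z_norm (-1) a \<sigma> (\<lambda>\<xi>. sol t \<xi> - sol t0 \<xi>)) \<longlongrightarrow> 0) (at t0 within {0..})" if t0: "t0 \<ge> 0" for t0
    \<comment> \<open>Dominated convergence is available along sequences, so the limit in
      \<open>t\<close> is tested on them.\<close>
    unfolding tendsto_at_iff_sequentially comp_def
  proof (intro allI impI)
    fix X assume "\<forall>i. X i \<in> {0..} - {t0}" and lim: "X \<longlonglongrightarrow> t0"
    then have X: "X i \<ge> 0" for i by auto
    have "(\<lambda>i. Z_norm (-1) a \<sigma> (\<lambda>\<xi>. sol (X i) \<xi> - sol t0 \<xi>)) \<longlonglongrightarrow> (\<integral>\<^sup>+ (\<xi>::real^3). 0 \<partial>lborel)"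
      unfolding Z_norm_minus1_eq
    proof (rule nn_integral_dominated_convergence[where w="\<lambda>\<xi>. 2 * (inverse (norm \<xi>) * (?w \<xi> * envel_lim \<xi>))"])
      show "(\<integral>\<^sup>+ \<xi>. 2 * (inverse (norm \<xi>) * (?w \<xi> * envel_lim \<xi>)) \<partial>lborel) < \<infinity>"
        using envel by (subst nn_integral_cmult) (auto simp: ennreal_mult_less_top)
      show "AE \<xi> in lborel. inverse (norm \<xi>) * (?w \<xi> * norm (sol (X i) \<xi> - sol t0 \<xi>))
         \<le> 2 * (inverse (norm \<xi>) * (?w \<xi> * envel_lim \<xi>))" for i
      proof (rule AE_I2)
        fix \<xi>
        have "ennreal (norm (sol (X i) \<xi> - sol t0 \<xi>)) \<le> ennreal (norm (sol (X i) \<xi>)) + ennreal (norm (sol t0 \<xi>))"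
          by (simp add: ennreal_plus[symmetric] ennreal_leI norm_triangle_ineq4 del: ennreal_plus)
        also have "\<dots> \<le> envel_lim \<xi> + envel_lim \<xi>" by (intro add_mono norm_le X t0)
        finally have "ennreal (norm (sol (X i) \<xi> - sol t0 \<xi>)) \<le> 2 * envel_lim \<xi>" by (simp add: mult_2)
        then have "inverse (norm \<xi>) * (?w \<xi> * norm (sol (X i) \<xi> - sol t0 \<xi>))
           \<le> inverse (norm \<xi>) * (?w \<xi> * (2 * envel_lim \<xi>))"
          by (intro mult_left_mono) auto
        then show "inverse (norm \<xi>) * (?w \<xi> * norm (sol (X i) \<xi> - sol t0 \<xi>))
           \<le> 2 * (inverse (norm \<xi>) * (?w \<xi> * envel_lim \<xi>))" by (simp add: mult_ac)
      qed
      show "AE \<xi> in lborel. (\<lambda>i. inverse (norm \<xi>) * (?w \<xi> * norm (sol (X i) \<xi> - sol t0 \<xi>))) \<longlonglongrightarrow> 0"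
        using AE_good
      proof eventually_elim
        case (elim \<xi>)
        have "(\<lambda>i. norm (sol (X i) \<xi> - sol t0 \<xi>)) \<longlonglongrightarrow> 0"
          by (intro tendsto_norm_zero LIM_zero sol_continuous_pointwise elim lim X t0)
        then have "(\<lambda>i. ennreal (norm (sol (X i) \<xi> - sol t0 \<xi>))) \<longlonglongrightarrow> 0"
          by (subst ennreal_tendsto_0_iff) auto
        then have "(\<lambda>i. inverse (norm \<xi>) * (?w \<xi> * norm (sol (X i) \<xi> - sol t0 \<xi>))) \<longlonglongrightarrow> inverse (norm \<xi>) * (?w \<xi> * 0)"
          by (intro ennreal_tendsto_cmult) auto
        then show ?case by simp
      qed
    qed measurable
    then show "(\<lambda>i. Z_norm (-1) a \<sigma> (\<lambda>\<xi>. sol (X i) \<xi> - sol t0 \<xi>)) \<longlonglongrightarrow> 0" by simp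
  qed
  moreover have "(\<integral>\<^sup>+ t. indicator {0..} t * Z_norm 1 a \<sigma> (sol t) \<partial>lborel) < \<infinity>"
  proof -
    \<comment> \<open>Here the bound must be \<open>major_lim\<close>, which decays in time; the
      constant-in-time \<open>envel_lim\<close> would not be integrable.\<close>
    have "(\<integral>\<^sup>+ t. indicator {0..} t * Z_norm 1 a \<sigma> (sol t) \<partial>lborel)
       \<le> (\<integral>\<^sup>+ t. (\<integral>\<^sup>+ \<xi>. (norm \<xi> * ?w \<xi>) * (indicator {0..} t * major_lim t \<xi>) \<partial>lborel) \<partial>lborel)"
    proof (rule nn_integral_mono)
      fix t :: real
      have "Z_norm 1 a \<sigma> (sol t) \<le> (\<integral>\<^sup>+ \<xi>. (norm \<xi> * ?w \<xi>) * major_lim t \<xi> \<partial>lborel)" if "t \<ge> 0"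
        unfolding Z_norm_1_eq mult.assoc by (intro nn_integral_mono mult_left_mono norm_sol_le that) auto
      then show "indicator {0..} t * Z_norm 1 a \<sigma> (sol t)
         \<le> (\<integral>\<^sup>+ \<xi>. (norm \<xi> * ?w \<xi>) * (indicator {0..} t * major_lim t \<xi>) \<partial>lborel)"
        by (auto split: split_indicator)
    qed
    also have "\<dots> = (\<integral>\<^sup>+ \<xi>. (\<integral>\<^sup>+ t. (norm \<xi> * ?w \<xi>) * (indicator {0..} t * major_lim t \<xi>) \<partial>lborel) \<partial>lborel)"
      by (rule lborel_pair.Fubini'[symmetric]) measurable
    also have "\<dots> \<le> (\<integral>\<^sup>+ \<xi>. ennreal (1 / \<nu>) * (inverse (norm \<xi>) * (?w \<xi> * envel_lim \<xi>)) \<partial>lborel)"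
    proof (rule nn_integral_mono_AE, rule AE_mp[OF AE_lborel_neq0], rule AE_I2, rule impI)
      fix \<xi> :: "real^3" assume \<xi>: "\<xi> \<noteq> 0"
      have "(\<integral>\<^sup>+ t. (norm \<xi> * ?w \<xi>) * (indicator {0..} t * major_lim t \<xi>) \<partial>lborel)
         = (norm \<xi> * ?w \<xi>) * (\<integral>\<^sup>+ t. indicator {0..} t * major_lim t \<xi> \<partial>lborel)"
        by (rule nn_integral_cmult) measurable
      also have "\<dots> \<le> (norm \<xi> * ?w \<xi>) * (ennreal (1 / (\<nu> * (norm \<xi>)\<^sup>2)) * envel_lim \<xi>)"
        by (intro mult_left_mono nn_integral_major_lim_le \<xi>) auto
      also have "\<dots> = (ennreal (norm \<xi>) * ennreal (1 / (\<nu> * (norm \<xi>)\<^sup>2))) * (?w \<xi> * envel_lim \<xi>)"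
        by (simp only: mult_ac)
      also have "ennreal (norm \<xi>) * ennreal (1 / (\<nu> * (norm \<xi>)\<^sup>2)) = ennreal (1 / \<nu>) * ennreal (inverse (norm \<xi>))"
        using \<xi> nu_pos by (simp add: ennreal_mult[symmetric] field_simps power2_eq_square)
      finally show "(\<integral>\<^sup>+ t. (norm \<xi> * ?w \<xi>) * (indicator {0..} t * major_lim t \<xi>) \<partial>lborel)
         \<le> ennreal (1 / \<nu>) * (inverse (norm \<xi>) * (?w \<xi> * envel_lim \<xi>))" by (simp add: mult.assoc)
    qed
    also have "\<dots> = ennreal (1 / \<nu>) * (\<integral>\<^sup>+ \<xi>. inverse (norm \<xi>) * (?w \<xi> * envel_lim \<xi>) \<partial>lborel)"
      by (rule nn_integral_cmult) measurable
    also have "\<dots> < \<infinity>" using envel by (auto simp: ennreal_mult_less_top)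
    finally show ?thesis .
  qed
  ultimately show ?thesis
    unfolding sol_class_def using sol_div_free[OF u0(1)] sol_real_field[OF u0(2)] by blast
qed

end

section \<open>Choice of the shift \<open>R\<close> and existence\<close>

lemma NSE_mild_existence:
  fixes a \<sigma> \<nu> :: real and u0 :: fvec
  assumes "a > 0" and "\<sigma> > 1" and "\<nu> > 0"
    and u0: "in_Z (-1) a \<sigma> u0" "div_free u0" "real_field u0"
    and small: "X_minus1_norm u0 < ennreal \<nu>"
  shows "\<exists>u. sol_class a \<sigma> u \<and> NSE_mild \<nu> u0 u"
proof -
  define \<theta> where "\<theta> = 1 / \<sigma>"
  have \<theta>: "0 < \<theta>" "\<theta> < 1" using assms by (auto simp: \<theta>_def)
  have [measurable]: "u0 \<in> borel_measurable borel" using u0(1) by (simp add: in_Z_def)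
  have "(\<lambda>n. \<integral>\<^sup>+ \<xi>. inverse (norm \<xi>) * (ennreal (gweight a \<theta> (real (Suc n)) \<xi>) * norm (u0 \<xi>)) \<partial>lborel)
      \<longlonglongrightarrow> (\<integral>\<^sup>+ \<xi>. ennreal (norm (u0 \<xi>) / norm \<xi>) \<partial>lborel)"
  proof (rule nn_integral_dominated_convergence[where
        w="\<lambda>\<xi>. inverse (norm \<xi>) * (ennreal (exp (a * norm \<xi> powr \<theta>)) * norm (u0 \<xi>))"])
    show "(\<integral>\<^sup>+ \<xi>. inverse (norm \<xi>) * (ennreal (exp (a * norm \<xi> powr \<theta>)) * norm (u0 \<xi>)) \<partial>lborel) < \<infinity>"
      using u0(1) by (simp add: in_Z_def Z_norm_minus1_eq \<theta>_def)
    show "AE \<xi> in lborel. inverse (norm \<xi>) * (ennreal (gweight a \<theta> (real (Suc n)) \<xi>) * norm (u0 \<xi>))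
       \<le> inverse (norm \<xi>) * (ennreal (exp (a * norm \<xi> powr \<theta>)) * norm (u0 \<xi>))" for n
      using assms \<theta> by (intro AE_I2 mult_left_mono mult_right_mono ennreal_leI gweight_le_gevrey) auto
    show "AE \<xi> in lborel. (\<lambda>n. inverse (norm \<xi>) * (ennreal (gweight a \<theta> (real (Suc n)) \<xi>) * norm (u0 \<xi>)))
        \<longlonglongrightarrow> ennreal (norm (u0 \<xi>) / norm \<xi>)"
    proof (rule AE_I2)
      fix \<xi>
      have "(\<lambda>n. ennreal (inverse (norm \<xi>) * norm (u0 \<xi>) * gweight a \<theta> (real (Suc n)) \<xi>))
        \<longlonglongrightarrow> ennreal (inverse (norm \<xi>) * norm (u0 \<xi>) * 1)"
        by (intro tendsto_ennrealI tendsto_intros gweight_tendsto_1 \<theta>)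
      moreover have "ennreal (inverse (norm \<xi>) * norm (u0 \<xi>) * gweight a \<theta> (real (Suc n)) \<xi>)
          = inverse (norm \<xi>) * (ennreal (gweight a \<theta> (real (Suc n)) \<xi>) * norm (u0 \<xi>))" for n
        by (simp add: ennreal_mult gweight_def mult_ac)
      ultimately show "(\<lambda>n. inverse (norm \<xi>) * (ennreal (gweight a \<theta> (real (Suc n)) \<xi>) * norm (u0 \<xi>)))
        \<longlonglongrightarrow> ennreal (norm (u0 \<xi>) / norm \<xi>)" by (simp add: divide_inverse mult.commute)
    qed
  qed measurable
  \<comment> \<open>The strict inequality for the limiting norm is inherited by some finite
    shift.\<close>
  from order_tendstoD(2)[OF this small[unfolded X_minus1_norm_def]]
  obtain n where n: "(\<integral>\<^sup>+ \<xi>. inverse (norm \<xi>) * (ennreal (gweight a \<theta> (real (Suc n)) \<xi>) * norm (u0 \<xi>)) \<partial>lborel) < ennreal \<nu>"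
    by (auto simp: eventually_sequentially)
  define R where "R = real (Suc n)"
  have R: "R > 0" by (simp add: R_def)
  interpret small_data \<nu> u0 "\<lambda>\<xi>. ennreal (gweight a \<theta> R \<xi>)"
  proof
    show "ennreal (gweight a \<theta> R (\<xi> + \<eta>)) \<le> ennreal (gweight a \<theta> R \<xi>) * ennreal (gweight a \<theta> R \<eta>)" for \<xi> \<eta>
      using gweight_submult[OF assms(1) R \<theta>, of \<xi> \<eta>] by (subst ennreal_mult[symmetric]) (auto simp: gweight_def)
    show "1 \<le> ennreal (gweight a \<theta> R \<xi>)" for \<xi>
      using gweight_ge_1[OF assms(1) R \<theta>(1), of \<xi>] by simp
  qed (use assms n in \<open>auto simp: R_def\<close>)
  have "ennreal (exp (a * norm \<xi> powr (1 / \<sigma>))) \<le> ennreal (exp (a * R powr \<theta>)) * ennreal (gweight a \<theta> R \<xi>)" for \<xi>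
    using gevrey_le_gweight[OF assms(1) R \<theta>(1), of \<xi>]
    by (subst ennreal_mult[symmetric]) (auto simp: gweight_def \<theta>_def)
  from sol_sol_class[OF this u0(2,3)] sol_NSE_mild show ?thesis by blast
qed

section \<open>Uniqueness\<close>

text \<open>Absolute continuity of the integral, uniform in the position of the interval: the part
  of \<open>g\<close> above a high level \<open>n\<close> has small mass, and the rest is at most
  \<open>n\<close> times the length.\<close>

lemma nn_integral_short_interval:
  fixes g :: "real \<Rightarrow> ennreal"
  assumes [measurable]: "g \<in> borel_measurable borel"
    and fin: "(\<integral>\<^sup>+ s. indicator {0..T} s * g s \<partial>lborel) < \<infinity>" and "\<epsilon> > 0"
  obtains \<delta> where "\<delta> > 0"
    "\<And>t0 t1. 0 \<le> t0 \<Longrightarrow> t0 \<le> t1 \<Longrightarrow> t1 \<le> T \<Longrightarrow> t1 \<le> t0 + \<delta> \<Longrightarrow>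
       (\<integral>\<^sup>+ s. indicator {t0<..t1} s * g s \<partial>lborel) \<le> ennreal \<epsilon>"
proof -
  let ?g = "\<lambda>n s. if ennreal (real n) < g s then indicator {0..T} s * g s else 0"
  have "AE s in lborel. indicator {0..T} s * g s \<noteq> \<infinity>"
    by (rule nn_integral_PInf_AE) (use fin in auto)
  then have "AE s in lborel. (\<lambda>n. ?g n s) \<longlonglongrightarrow> 0"
  proof eventually_elim
    case (elim s)
    show ?case
    proof (cases "g s")
      case (real r)
      obtain m :: nat where m: "r \<le> real m" using real_arch_simple by blast
      have "?g n s = 0" if "n \<ge> m" for n
      proof -
        have "g s \<le> ennreal (real n)" using real m that by (simp add: ennreal_leI)
        then show ?thesis by (simp add: not_less)
      qed
      then have "\<forall>\<^sub>F n in sequentially. ?g n s = 0"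
        unfolding eventually_sequentially by blast
      then show ?thesis by (rule tendsto_eventually)
    next
      case top
      with elim have "s \<notin> {0..T}" by (auto split: split_indicator_asm)
      then have "?g n s = 0" for n by (simp only: indicator_simps mult_zero_left if_cancel not_False_eq_True)
      then show ?thesis by simp
    qed
  qed
  then have "(\<lambda>n. \<integral>\<^sup>+ s. ?g n s \<partial>lborel) \<longlonglongrightarrow> (\<integral>\<^sup>+ (s::real). 0 \<partial>lborel)"
    using fin by (intro nn_integral_dominated_convergence[where w="\<lambda>s. indicator {0..T} s * g s"]) auto
  then have "(\<lambda>n. \<integral>\<^sup>+ s. ?g n s \<partial>lborel) \<longlonglongrightarrow> 0" by simp
  from order_tendstoD(2)[OF this, of "ennreal (\<epsilon> / 2)"] \<open>\<epsilon> > 0\<close>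
  obtain n where n: "(\<integral>\<^sup>+ s. ?g n s \<partial>lborel) < ennreal (\<epsilon> / 2)"
    by (auto simp: eventually_sequentially)
  \<comment> \<open>This lets the part below level \<open>n\<close> contribute at most \<epsilon> /
    2; the summand 1 covers n = 0.\<close>
  define \<delta> where "\<delta> = \<epsilon> / (2 * (real n + 1))"
  show thesis
  proof (rule that[of \<delta>])
    show "\<delta> > 0" using \<open>\<epsilon> > 0\<close> by (simp add: \<delta>_def)
    fix t0 t1 assume t: "0 \<le> t0" "t0 \<le> t1" "t1 \<le> T" "t1 \<le> t0 + \<delta>"
    have "(\<integral>\<^sup>+ s. indicator {t0<..t1} s * g s \<partial>lborel)
       \<le> (\<integral>\<^sup>+ s. ?g n s + ennreal (real n) * indicator {t0<..t1} s \<partial>lborel)"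
    proof (rule nn_integral_mono)
      show "indicator {t0<..t1} s * g s \<le> ?g n s + ennreal (real n) * indicator {t0<..t1} s" for s
        using t by (auto split: split_indicator simp: not_less)
    qed
    also have "\<dots> = (\<integral>\<^sup>+ s. ?g n s \<partial>lborel) + ennreal (real n) * ennreal (t1 - t0)"
      using t by (subst nn_integral_add) (auto simp: nn_integral_cmult)
    also have "\<dots> \<le> ennreal (\<epsilon> / 2) + ennreal (real n * (t1 - t0))"
      using n t by (intro add_mono) (auto simp: ennreal_mult)
    also have "\<dots> \<le> ennreal (\<epsilon> / 2) + ennreal (\<epsilon> / 2)"
    proof (intro add_left_mono ennreal_leI)
      have "real n * (t1 - t0) \<le> (real n + 1) * \<delta>" using t by (intro mult_mono) auto
      also have "\<dots> = \<epsilon> / 2" by (simp add: \<delta>_def field_simps)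
      finally show "real n * (t1 - t0) \<le> \<epsilon> / 2" .
    qed
    also have "\<dots> = ennreal \<epsilon>"
      using \<open>\<epsilon> > 0\<close> by (simp add: ennreal_plus[symmetric] del: ennreal_plus)
    finally show "(\<integral>\<^sup>+ s. indicator {t0<..t1} s * g s \<partial>lborel) \<le> ennreal \<epsilon>" .
  qed
qed

text \<open>Finiteness is essential: infinity satisfies the inequality too.\<close>

lemma ennreal_mult_self_le_zero:
  fixes i :: ennreal
  assumes "i < \<infinity>" "i\<^sup>2 \<le> ennreal (1/2) * i\<^sup>2"
  shows "i = 0"
proof -
  obtain r where r: "i = ennreal r" "r \<ge> 0" using assms(1) by (cases i) auto
  have "ennreal (1/2) * i\<^sup>2 = ennreal (1/2 * r\<^sup>2)"
    unfolding r by (subst ennreal_mult) (auto simp: ennreal_power r(2))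
  with assms(2) have "ennreal (r\<^sup>2) \<le> ennreal (1/2 * r\<^sup>2)"
    by (simp only: r(1) ennreal_power[OF r(2)])
  then have "r\<^sup>2 \<le> 1/2 * r\<^sup>2" by (subst (asm) ennreal_le_iff) auto
  then have "r\<^sup>2 \<le> 0" by linarith
  then show ?thesis by (simp add: r)
qed

text \<open>If the integral I vanishes up to t0, Cauchy--Schwarz on (t0, t1] and \<open>est\<close>
  bound I(t1)^2 by c I(t1)^2 times the integral of b^2 over (t0, t1]. The admissible step length is
  uniform, so finitely many steps reach \<open>T\<close>. The bound by \<open>b\<close> keeps I
  finite, so that it can be absorbed.\<close>

lemma quadratic_gronwall:
  fixes x b :: "real \<Rightarrow> ennreal" and c T :: real
  assumes [measurable]: "x \<in> borel_measurable borel" "b \<in> borel_measurable borel"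
    and fin: "(\<integral>\<^sup>+ s. indicator {0..T} s * (b s)\<^sup>2 \<partial>lborel) < \<infinity>"
    and xb: "\<And>s. 0 \<le> s \<Longrightarrow> s \<le> T \<Longrightarrow> x s \<le> b s"
    and "c > 0" and T: "T \<ge> 0"
    and est: "\<And>t. 0 \<le> t \<Longrightarrow> t \<le> T \<Longrightarrow>
      (\<integral>\<^sup>+ s. indicator {0..t} s * (x s)\<^sup>2 \<partial>lborel) \<le> ennreal c * (\<integral>\<^sup>+ s. indicator {0..t} s * (x s * b s) \<partial>lborel)\<^sup>2"
  shows "(\<integral>\<^sup>+ s. indicator {0..T} s * (x s * b s) \<partial>lborel) = 0"
proof -
  define I where "I t = (\<integral>\<^sup>+ s. indicator {0..t} s * (x s * b s) \<partial>lborel)" for t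
  have I_fin: "I t < \<infinity>" if "t \<le> T" for t
  proof -
    have "I t \<le> (\<integral>\<^sup>+ s. indicator {0..T} s * (b s)\<^sup>2 \<partial>lborel)"
      unfolding I_def power2_eq_square using that xb
      by (intro nn_integral_mono) (auto split: split_indicator intro!: mult_right_mono)
    with fin show ?thesis by (rule le_less_trans[rotated])
  qed
  \<comment> \<open>This threshold makes the absorption factor equal to 1/2.\<close>
  have "1 / (2 * c) > 0" using \<open>c > 0\<close> by simp
  then obtain \<delta> where \<delta>: "\<delta> > 0"
    "\<And>t0 t1. 0 \<le> t0 \<Longrightarrow> t0 \<le> t1 \<Longrightarrow> t1 \<le> T \<Longrightarrow> t1 \<le> t0 + \<delta> \<Longrightarrow>
       (\<integral>\<^sup>+ s. indicator {t0<..t1} s * (b s)\<^sup>2 \<partial>lborel) \<le> ennreal (1 / (2 * c))"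
    using nn_integral_short_interval[of "\<lambda>s. (b s)\<^sup>2" T "1 / (2 * c)"] fin by auto
  have step: "I t1 = 0" if t: "0 \<le> t0" "t0 \<le> t1" "t1 \<le> T" "t1 \<le> t0 + \<delta>" and "I t0 = 0" for t0 t1
  proof -
    have "I t1 = I t0 + (\<integral>\<^sup>+ s. indicator {t0<..t1} s * (x s * b s) \<partial>lborel)"
      unfolding I_def using t
      by (subst nn_integral_add[symmetric]) (auto intro!: nn_integral_cong split: split_indicator)
    also have "\<dots> = (\<integral>\<^sup>+ s. (indicator {t0<..t1} s * x s) * (indicator {t0<..t1} s * b s) \<partial>lborel)"
      unfolding \<open>I t0 = 0\<close> by (auto intro!: nn_integral_cong split: split_indicator)
    finally have "(I t1)\<^sup>2 = (\<integral>\<^sup>+ s. (indicator {t0<..t1} s * x s) * (indicator {t0<..t1} s * b s) \<partial>lborel)\<^sup>2"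
      by simp
    also have "\<dots> \<le> (\<integral>\<^sup>+ s. (indicator {t0<..t1} s * x s)\<^sup>2 \<partial>lborel) * (\<integral>\<^sup>+ s. (indicator {t0<..t1} s * b s)\<^sup>2 \<partial>lborel)"
      by (rule Cauchy_Schwarz_nn_integral) measurable
    also have "\<dots> \<le> (\<integral>\<^sup>+ s. indicator {0..t1} s * (x s)\<^sup>2 \<partial>lborel) * (\<integral>\<^sup>+ s. indicator {t0<..t1} s * (b s)\<^sup>2 \<partial>lborel)"
      using t by (intro mult_mono nn_integral_mono) (auto split: split_indicator)
    also have "\<dots> \<le> (ennreal c * (I t1)\<^sup>2) * ennreal (1 / (2 * c))"
      unfolding I_def using t by (intro mult_mono est \<delta>(2)[OF t]) auto
    also have "\<dots> = (ennreal c * ennreal (1 / (2 * c))) * (I t1)\<^sup>2" by (simp only: mult_ac)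
    also have "ennreal c * ennreal (1 / (2 * c)) = ennreal (1/2)"
      using \<open>c > 0\<close> by (simp add: ennreal_mult[symmetric])
    finally show ?thesis using I_fin[OF t(3)] by (intro ennreal_mult_self_le_zero)
  qed
  have "I (min (real n * \<delta>) T) = 0" for n
  proof (induction n)
    case 0
    have "I 0 = (\<integral>\<^sup>+ (s::real). 0 \<partial>lborel)"
      unfolding I_def
    proof (rule nn_integral_cong_AE, rule AE_mp[OF AE_lborel_singleton[of 0]], rule AE_I2, rule impI)
      show "indicator {0..0} s * (x s * b s) = 0" if "s \<noteq> 0" for s using that by simp
    qed
    then show ?case using T by simp
  next
    case (Suc n)
    have eq: "real (Suc n) * \<delta> = real n * \<delta> + \<delta>" by (simp add: distrib_right)
    have "0 \<le> real n * \<delta>" using \<delta>(1) by simp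
    then show ?case
      unfolding eq by (intro step[OF _ _ _ _ Suc.IH]) (use \<delta>(1) T in linarith)+
  qed
  moreover obtain n where "T \<le> real n * \<delta>" using \<delta>(1) reals_Archimedean3[of \<delta>] by (meson less_imp_le)
  ultimately have "I T = 0" by (metis min.absorb2)
  then show ?thesis by (simp add: I_def)
qed

lemma Z_norm_triangle:
  assumes [measurable]: "f \<in> borel_measurable borel" "g \<in> borel_measurable borel"
  shows "Z_norm \<rho> a \<sigma> f \<le> Z_norm \<rho> a \<sigma> (\<lambda>\<xi>. f \<xi> - g \<xi>) + Z_norm \<rho> a \<sigma> g"
proof -
  let ?w = "\<lambda>\<xi>::real^3. norm \<xi> powr \<rho> * exp (a * norm \<xi> powr (1 / \<sigma>))"
  have "?w \<xi> * norm (f \<xi>) \<le> ?w \<xi> * norm (f \<xi> - g \<xi>) + ?w \<xi> * norm (g \<xi>)" for \<xi>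
    unfolding distrib_left[symmetric]
    using norm_triangle_sub[of "f \<xi>" "g \<xi>"] by (intro mult_left_mono) (auto simp: add.commute)
  then have "ennreal (?w \<xi> * norm (f \<xi>)) \<le> ennreal (?w \<xi> * norm (f \<xi> - g \<xi>)) + ennreal (?w \<xi> * norm (g \<xi>))" for \<xi>
    by (subst ennreal_plus[symmetric]) (simp_all add: ennreal_leI del: ennreal_plus)
  then have "Z_norm \<rho> a \<sigma> f \<le> (\<integral>\<^sup>+ \<xi>. ennreal (?w \<xi> * norm (f \<xi> - g \<xi>)) + ennreal (?w \<xi> * norm (g \<xi>)) \<partial>lborel)"
    unfolding Z_norm_def by (intro nn_integral_mono)
  also have "\<dots> = Z_norm \<rho> a \<sigma> (\<lambda>\<xi>. f \<xi> - g \<xi>) + Z_norm \<rho> a \<sigma> g"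
    unfolding Z_norm_def by (rule nn_integral_add) measurable
  finally show ?thesis .
qed

text \<open>Continuity is available only through norms of differences, so boundedness comes from
  sequential compactness: times with norms exceeding every \<open>n\<close> would accumulate at some
  \<open>l\<close>, near which the norm is at most 1 plus its value at \<open>l\<close>.\<close>

lemma sol_class_bounded:
  assumes u: "sol_class a \<sigma> u"
  obtains M :: real where "\<And>t. 0 \<le> t \<Longrightarrow> t \<le> T \<Longrightarrow> Z_norm (-1) a \<sigma> (u t) \<le> ennreal M"
proof (rule ccontr)
  assume *: "\<not> thesis"
  have "\<exists>t. 0 \<le> t \<and> t \<le> T \<and> ennreal (real n) < Z_norm (-1) a \<sigma> (u t)" for n
    using * that[of "real n"] by (force simp: not_le)
  then obtain t where t: "\<And>n. 0 \<le> t n" "\<And>n. t n \<le> T" "\<And>n. ennreal (real n) < Z_norm (-1) a \<sigma> (u (t n))"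
    by metis
  have "compact {0..T}" by simp
  then obtain l r where l: "l \<in> {0..T}" "strict_mono r" "(t \<circ> r) \<longlonglongrightarrow> l"
    using t unfolding compact_def by (metis atLeastAtMost_iff)
  have "((\<lambda>t. Z_norm (-1) a \<sigma> (\<lambda>\<xi>. u t \<xi> - u l \<xi>)) \<longlongrightarrow> 0) (at l within {0..})"
    using u l(1) by (auto simp: sol_class_def)
  \<comment> \<open>The punctured limit says nothing if the subsequence hits \<open>l\<close>;
    including the value 0 at \<open>l\<close> covers that case.\<close>
  then have "continuous (at l within {0..}) (\<lambda>t. Z_norm (-1) a \<sigma> (\<lambda>\<xi>. u t \<xi> - u l \<xi>))"
    unfolding continuous_within by (simp add: Z_norm_def)
  then have "(\<lambda>n. Z_norm (-1) a \<sigma> (\<lambda>\<xi>. u ((t \<circ> r) n) \<xi> - u l \<xi>)) \<longlonglongrightarrow> 0"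
    unfolding continuous_within_sequentially using l(3) t(1)
    by (force simp: Z_norm_def comp_def)
  from order_tendstoD(2)[OF this, of 1]
  obtain N where N: "\<And>n. n \<ge> N \<Longrightarrow> Z_norm (-1) a \<sigma> (\<lambda>\<xi>. u (t (r n)) \<xi> - u l \<xi>) < 1"
    by (auto simp: eventually_sequentially)
  have Z: "in_Z (-1) a \<sigma> (u s)" if "s \<ge> 0" for s using u that by (auto simp: sol_class_def)
  have "Z_norm (-1) a \<sigma> (u l) < \<infinity>" using Z[of l] l(1) by (auto simp: in_Z_def)
  then obtain m where m: "Z_norm (-1) a \<sigma> (u l) = ennreal m" "m \<ge> 0" by (cases "Z_norm (-1) a \<sigma> (u l)") auto
  obtain k :: nat where k: "1 + m \<le> real k" using real_arch_simple by blast
  define n where "n = max N k"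
  have "ennreal (real (r n)) < Z_norm (-1) a \<sigma> (u (t (r n)))" by (rule t(3))
  also have "\<dots> \<le> Z_norm (-1) a \<sigma> (\<lambda>\<xi>. u (t (r n)) \<xi> - u l \<xi>) + Z_norm (-1) a \<sigma> (u l)"
    using Z[of "t (r n)"] Z[of l] l(1) t(1) by (intro Z_norm_triangle) (auto simp: in_Z_def)
  also have "\<dots> \<le> 1 + ennreal m"
    unfolding m using N[of n] by (intro add_right_mono) (auto simp: n_def)
  also have "\<dots> = ennreal (1 + m)" using m(2) by simp
  also have "\<dots> \<le> ennreal (real (r n))"
    using k seq_suble[OF l(2), of n] by (intro ennreal_leI) (auto simp: n_def)
  finally show False by simp
qed

text \<open>The heat estimates of the existence part, applied to the difference, bound both its
  weighted norms linearly by I: \<open>y_le\<close> uniformly in time, \<open>z_le\<close> in L1 of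
  time. Interpolation multiplies them into a bound quadratic in I, which is the hypothesis of
  \<open>quadratic_gronwall\<close>.\<close>

lemma NSE_mild_uniqueness_measurable:
  fixes u v :: "real \<Rightarrow> fvec" and M T :: real
  assumes um [measurable]: "case_prod u \<in> borel_measurable (borel \<Otimes>\<^sub>M borel)"
    and vm [measurable]: "case_prod v \<in> borel_measurable (borel \<Otimes>\<^sub>M borel)"
    and "\<nu> > 0" "T \<ge> 0"
    and bdd: "\<And>t. 0 \<le> t \<Longrightarrow> t \<le> T \<Longrightarrow> (\<integral>\<^sup>+ \<xi>. inverse (norm \<xi>) * ennreal (norm (u t \<xi>)) \<partial>lborel) \<le> ennreal M"
      "\<And>t. 0 \<le> t \<Longrightarrow> t \<le> T \<Longrightarrow> (\<integral>\<^sup>+ \<xi>. inverse (norm \<xi>) * ennreal (norm (v t \<xi>)) \<partial>lborel) \<le> ennreal M"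
    and int: "(\<integral>\<^sup>+ t. indicator {0..T} t * (\<integral>\<^sup>+ \<xi>. norm \<xi> * ennreal (norm (u t \<xi>)) \<partial>lborel) \<partial>lborel) < \<infinity>"
      "(\<integral>\<^sup>+ t. indicator {0..T} t * (\<integral>\<^sup>+ \<xi>. norm \<xi> * ennreal (norm (v t \<xi>)) \<partial>lborel) \<partial>lborel) < \<infinity>"
    and mild: "NSE_mild \<nu> u0 u" "NSE_mild \<nu> u0 v"
  shows "AE \<xi> in lborel. u T \<xi> = v T \<xi>"
proof -
  define B where "B s \<eta> = ennreal (norm (u s \<eta>)) + ennreal (norm (v s \<eta>))" for s \<eta>
  define d where "d s \<eta> = ennreal (norm (u s \<eta> - v s \<eta>))" for s \<eta>
  define b where "b s = (\<integral>\<^sup>+ \<eta>. B s \<eta> \<partial>lborel)" for s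
  define x where "x s = (\<integral>\<^sup>+ \<eta>. d s \<eta> \<partial>lborel)" for s
  define h where "h s \<xi> = econv (d s) (\<lambda>\<eta>. norm (u s \<eta>)) \<xi> + econv (\<lambda>\<eta>. norm (v s \<eta>)) (d s) \<xi>" for s \<xi>
  define I where "I t = (\<integral>\<^sup>+ s. indicator {0..t} s * (x s * b s) \<partial>lborel)" for t
  have [measurable]: "case_prod B \<in> borel_measurable (borel \<Otimes>\<^sub>M borel)" "case_prod d \<in> borel_measurable (borel \<Otimes>\<^sub>M borel)"
    unfolding B_def d_def by measurable
  have [measurable]: "b \<in> borel_measurable borel" "x \<in> borel_measurable borel"
    unfolding b_def[abs_def] x_def[abs_def] by measurable
  have [measurable]: "case_prod h \<in> borel_measurable (borel \<Otimes>\<^sub>M borel)"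
    unfolding h_def by measurable
  \<comment> \<open>Polarisation uses one factor of each solution, so the masses add up exactly to
    \<open>b s\<close>.\<close>
  have h_int: "(\<integral>\<^sup>+ \<xi>. h s \<xi> \<partial>lborel) = x s * b s" for s
  proof -
    have "(\<integral>\<^sup>+ \<xi>. h s \<xi> \<partial>lborel) = x s * (\<integral>\<^sup>+ \<eta>. norm (u s \<eta>) \<partial>lborel) + (\<integral>\<^sup>+ \<eta>. norm (v s \<eta>) \<partial>lborel) * x s"
      unfolding h_def x_def by (subst nn_integral_add) (auto simp: nn_integral_econv)
    also have "\<dots> = x s * b s"
      unfolding b_def B_def by (subst nn_integral_add) (auto simp: distrib_left mult.commute)
    finally show ?thesis .
  qed
  have b2: "(\<integral>\<^sup>+ s. indicator {0..T} s * (b s)\<^sup>2 \<partial>lborel) < \<infinity>"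
  proof -
    have "(b s)\<^sup>2 \<le> (ennreal M + ennreal M) * ((\<integral>\<^sup>+ \<xi>. norm \<xi> * ennreal (norm (u s \<xi>)) \<partial>lborel)
        + (\<integral>\<^sup>+ \<xi>. norm \<xi> * ennreal (norm (v s \<xi>)) \<partial>lborel))" if s: "0 \<le> s" "s \<le> T" for s
    proof -
      have "(b s)\<^sup>2 \<le> (\<integral>\<^sup>+ \<xi>. inverse (norm \<xi>) * B s \<xi> \<partial>lborel) * (\<integral>\<^sup>+ \<xi>. norm \<xi> * B s \<xi> \<partial>lborel)"
        unfolding b_def by (rule L1_interpolation) measurable
      also have "(\<integral>\<^sup>+ \<xi>. inverse (norm \<xi>) * B s \<xi> \<partial>lborel)
         = (\<integral>\<^sup>+ \<xi>. inverse (norm \<xi>) * ennreal (norm (u s \<xi>)) \<partial>lborel) + (\<integral>\<^sup>+ \<xi>. inverse (norm \<xi>) * ennreal (norm (v s \<xi>)) \<partial>lborel)"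
        unfolding B_def distrib_left by (rule nn_integral_add) measurable
      also have "(\<integral>\<^sup>+ \<xi>. norm \<xi> * B s \<xi> \<partial>lborel)
         = (\<integral>\<^sup>+ \<xi>. norm \<xi> * ennreal (norm (u s \<xi>)) \<partial>lborel) + (\<integral>\<^sup>+ \<xi>. norm \<xi> * ennreal (norm (v s \<xi>)) \<partial>lborel)"
        unfolding B_def distrib_left by (rule nn_integral_add) measurable
      finally show ?thesis
        using bdd(1)[OF s] bdd(2)[OF s] by (rule_tac order_trans) (auto intro!: mult_right_mono add_mono)
    qed
    then have "(\<integral>\<^sup>+ s. indicator {0..T} s * (b s)\<^sup>2 \<partial>lborel)
      \<le> (\<integral>\<^sup>+ s. (ennreal M + ennreal M) * (indicator {0..T} s * (\<integral>\<^sup>+ \<xi>. norm \<xi> * ennreal (norm (u s \<xi>)) \<partial>lborel)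
           + indicator {0..T} s * (\<integral>\<^sup>+ \<xi>. norm \<xi> * ennreal (norm (v s \<xi>)) \<partial>lborel)) \<partial>lborel)"
      by (intro nn_integral_mono) (auto split: split_indicator)
    also have "\<dots> = (ennreal M + ennreal M) * ((\<integral>\<^sup>+ s. indicator {0..T} s * (\<integral>\<^sup>+ \<xi>. norm \<xi> * ennreal (norm (u s \<xi>)) \<partial>lborel) \<partial>lborel)
           + (\<integral>\<^sup>+ s. indicator {0..T} s * (\<integral>\<^sup>+ \<xi>. norm \<xi> * ennreal (norm (v s \<xi>)) \<partial>lborel) \<partial>lborel))"
      by (subst nn_integral_cmult, measurable, subst nn_integral_add) auto
    also have "\<dots> < \<infinity>" using int by (auto simp: ennreal_mult_less_top)
    finally show ?thesis .
  qed
  have fin: "AE \<xi> in lborel. AE s in lborel. 0 \<le> s \<and> s \<le> T \<longrightarrow> econv (B s) (B s) \<xi> < \<infinity>"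
  proof -
    have "(\<integral>\<^sup>+ \<xi>. (\<integral>\<^sup>+ s. indicator {0..T} s * econv (B s) (B s) \<xi> \<partial>lborel) \<partial>lborel)
       = (\<integral>\<^sup>+ s. (\<integral>\<^sup>+ \<xi>. indicator {0..T} s * econv (B s) (B s) \<xi> \<partial>lborel) \<partial>lborel)"
      by (rule lborel_pair.Fubini') measurable
    also have "\<dots> = (\<integral>\<^sup>+ s. indicator {0..T} s * (b s)\<^sup>2 \<partial>lborel)"
      by (subst nn_integral_cmult) (auto simp: nn_integral_econv b_def power2_eq_square)
    finally have "AE \<xi> in lborel. (\<integral>\<^sup>+ s. indicator {0..T} s * econv (B s) (B s) \<xi> \<partial>lborel) \<noteq> \<infinity>"
      using b2 by (intro nn_integral_PInf_AE) auto
    then show ?thesis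
    proof eventually_elim
      case (elim \<xi>)
      then have "AE s in lborel. indicator {0..T} s * econv (B s) (B s) \<xi> \<noteq> \<infinity>"
        by (intro nn_integral_PInf_AE) auto
      then show ?case by eventually_elim (auto simp: less_top)
    qed
  qed
  \<comment> \<open>The cutoff at \<open>t1\<close> changes nothing for t \<le> t1, but it lets the
    estimates over the whole half-line return I(t1) instead of an integral over all times.\<close>
  have duh: "AE \<xi> in lborel. d t \<xi> \<le> eduhamel \<nu> (\<lambda>s \<xi>. indicator {..t1} s * h s \<xi>) t \<xi>"
    if t: "0 \<le> t" "t \<le> t1" "t1 \<le> T" for t t1
    using mild(1)[unfolded NSE_mild_def, rule_format, OF t(1)] mild(2)[unfolded NSE_mild_def, rule_format, OF t(1)] fin
  proof eventually_elim
    case (elim \<xi>)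
    have "d t \<xi> = ennreal (norm ((LINT s:{0..t}|lborel. duhamel_integrand \<nu> u t \<xi> s)
                      - (LINT s:{0..t}|lborel. duhamel_integrand \<nu> v t \<xi> s)))"
      unfolding d_def using elim(1,2) by (simp add: norm_minus_commute)
    also have "\<dots> \<le> eduhamel \<nu> (\<lambda>s \<xi>. econv (\<lambda>\<eta>. norm (u s \<eta> - v s \<eta>)) (\<lambda>\<eta>. norm (u s \<eta>)) \<xi>
                       + econv (\<lambda>\<eta>. norm (v s \<eta>)) (\<lambda>\<eta>. norm (u s \<eta> - v s \<eta>)) \<xi>) t \<xi>"
    proof (rule norm_duhamel_integral_diff_le[OF um vm])
      have le: "econv (\<lambda>\<eta>. norm (u s \<eta>)) (\<lambda>\<eta>. norm (u s \<eta>)) \<xi> \<le> econv (B s) (B s) \<xi>"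
        "econv (\<lambda>\<eta>. norm (v s \<eta>)) (\<lambda>\<eta>. norm (v s \<eta>)) \<xi> \<le> econv (B s) (B s) \<xi>" for s
        by (intro econv_mono; simp add: B_def)+
      show "AE s in lborel. 0 \<le> s \<and> s \<le> t \<longrightarrow>
        econv (\<lambda>\<eta>. norm (u s \<eta>)) (\<lambda>\<eta>. norm (u s \<eta>)) \<xi> < \<infinity> \<and>
        econv (\<lambda>\<eta>. norm (v s \<eta>)) (\<lambda>\<eta>. norm (v s \<eta>)) \<xi> < \<infinity>"
        using elim(3) by eventually_elim (use t le in \<open>auto intro: le_less_trans\<close>)
    qed (use elim in auto)
    also have "\<dots> \<le> eduhamel \<nu> (\<lambda>s \<xi>. indicator {..t1} s * h s \<xi>) t \<xi>"
      using t by (intro eduhamel_mono) (auto simp: h_def d_def[abs_def])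
    finally show ?case .
  qed
  have h_total: "(\<integral>\<^sup>+ \<xi>. (\<integral>\<^sup>+ s. indicator {0..} s * (indicator {..t1} s * h s \<xi>) \<partial>lborel) \<partial>lborel) = I t1" for t1
  proof -
    have "(\<integral>\<^sup>+ \<xi>. (\<integral>\<^sup>+ s. indicator {0..} s * (indicator {..t1} s * h s \<xi>) \<partial>lborel) \<partial>lborel)
       = (\<integral>\<^sup>+ s. (\<integral>\<^sup>+ \<xi>. indicator {0..} s * (indicator {..t1} s * h s \<xi>) \<partial>lborel) \<partial>lborel)"
      by (rule lborel_pair.Fubini') measurable
    also have "\<dots> = I t1"
      unfolding I_def
    proof (rule nn_integral_cong)
      show "(\<integral>\<^sup>+ \<xi>. indicator {0..} s * (indicator {..t1} s * h s \<xi>) \<partial>lborel) = indicator {0..t1} s * (x s * b s)" for s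
        using h_int[of s] by (auto split: split_indicator)
    qed
    finally show ?thesis .
  qed
  have y_le: "(\<integral>\<^sup>+ \<xi>. inverse (norm \<xi>) * d t \<xi> \<partial>lborel) \<le> ennreal (1 / 6) * I t1"
    if t: "0 \<le> t" "t \<le> t1" "t1 \<le> T" for t t1
  proof -
    let ?H = "\<lambda>\<xi>. \<integral>\<^sup>+ s. indicator {0..} s * (indicator {..t1} s * h s \<xi>) \<partial>lborel"
    have "(\<integral>\<^sup>+ \<xi>. inverse (norm \<xi>) * d t \<xi> \<partial>lborel) \<le> (\<integral>\<^sup>+ \<xi>. ennreal (1 / 6) * ?H \<xi> \<partial>lborel)"
    proof (rule nn_integral_mono_AE, use duh[OF t] AE_lborel_neq0 in eventually_elim)
      case (elim \<xi>)
      have "d t \<xi> \<le> ennreal (norm \<xi> / 6) * ?H \<xi>"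
        using elim(1) by (rule order_trans) (intro eduhamel_le \<open>\<nu> > 0\<close>, measurable)
      then have "inverse (norm \<xi>) * d t \<xi> \<le> inverse (norm \<xi>) * (ennreal (norm \<xi> / 6) * ?H \<xi>)"
        by (intro mult_left_mono) auto
      also have "\<dots> = (ennreal (inverse (norm \<xi>)) * ennreal (norm \<xi> / 6)) * ?H \<xi>" by (simp only: mult.assoc)
      also have "ennreal (inverse (norm \<xi>)) * ennreal (norm \<xi> / 6) = ennreal (1 / 6)"
        using elim(2) by (simp add: ennreal_mult[symmetric] field_simps)
      finally show ?case .
    qed
    also have "\<dots> = ennreal (1 / 6) * I t1"
      unfolding h_total[symmetric] by (rule nn_integral_cmult) measurable
    finally show ?thesis .
  qed
  have z_le: "(\<integral>\<^sup>+ t. indicator {0..t1} t * (\<integral>\<^sup>+ \<xi>. norm \<xi> * d t \<xi> \<partial>lborel) \<partial>lborel) \<le> ennreal (1 / (6 * \<nu>)) * I t1"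
    if t1: "0 \<le> t1" "t1 \<le> T" for t1
  proof -
    let ?h = "\<lambda>s \<xi>. indicator {..t1} s * h s \<xi>"
    let ?H = "\<lambda>\<xi>. \<integral>\<^sup>+ s. indicator {0..} s * ?h s \<xi> \<partial>lborel"
    have "(\<integral>\<^sup>+ t. indicator {0..t1} t * (\<integral>\<^sup>+ \<xi>. norm \<xi> * d t \<xi> \<partial>lborel) \<partial>lborel)
       \<le> (\<integral>\<^sup>+ t. (\<integral>\<^sup>+ \<xi>. norm \<xi> * (indicator {0..} t * eduhamel \<nu> ?h t \<xi>) \<partial>lborel) \<partial>lborel)"
    proof (rule nn_integral_mono)
      fix t
      show "indicator {0..t1} t * (\<integral>\<^sup>+ \<xi>. norm \<xi> * d t \<xi> \<partial>lborel)
         \<le> (\<integral>\<^sup>+ \<xi>. norm \<xi> * (indicator {0..} t * eduhamel \<nu> ?h t \<xi>) \<partial>lborel)"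
      proof (cases "0 \<le> t \<and> t \<le> t1")
        case True
        have "(\<integral>\<^sup>+ \<xi>. norm \<xi> * d t \<xi> \<partial>lborel) \<le> (\<integral>\<^sup>+ \<xi>. norm \<xi> * eduhamel \<nu> ?h t \<xi> \<partial>lborel)"
          using duh[of t t1] True t1
          by (intro nn_integral_mono_AE) (auto elim!: eventually_mono intro!: mult_left_mono)
        with True show ?thesis by simp
      qed simp
    qed
    also have "\<dots> = (\<integral>\<^sup>+ \<xi>. (\<integral>\<^sup>+ t. norm \<xi> * (indicator {0..} t * eduhamel \<nu> ?h t \<xi>) \<partial>lborel) \<partial>lborel)"
      by (rule lborel_pair.Fubini'[symmetric]) measurable
    also have "\<dots> = (\<integral>\<^sup>+ \<xi>. ennreal (1 / (6 * \<nu>)) * ?H \<xi> \<partial>lborel)"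
    proof (rule nn_integral_cong_AE, use AE_lborel_neq0 in eventually_elim)
      case (elim \<xi>)
      have "(\<integral>\<^sup>+ t. norm \<xi> * (indicator {0..} t * eduhamel \<nu> ?h t \<xi>) \<partial>lborel)
         = norm \<xi> * (\<integral>\<^sup>+ t. indicator {0..} t * eduhamel \<nu> ?h t \<xi> \<partial>lborel)"
        by (rule nn_integral_cmult) measurable
      also have "(\<integral>\<^sup>+ t. indicator {0..} t * eduhamel \<nu> ?h t \<xi> \<partial>lborel)
         = ennreal (1 / (\<nu> * (norm \<xi>)\<^sup>2)) * (ennreal (norm \<xi> / 6) * ?H \<xi>)"
        by (rule nn_integral_eduhamel) (use elim \<open>\<nu> > 0\<close> in auto)
      also have "ennreal (norm \<xi>) * (ennreal (1 / (\<nu> * (norm \<xi>)\<^sup>2)) * (ennreal (norm \<xi> / 6) * ?H \<xi>))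
         = (ennreal (norm \<xi>) * ennreal (1 / (\<nu> * (norm \<xi>)\<^sup>2)) * ennreal (norm \<xi> / 6)) * ?H \<xi>"
        by (simp only: mult.assoc)
      also have "ennreal (norm \<xi>) * ennreal (1 / (\<nu> * (norm \<xi>)\<^sup>2)) * ennreal (norm \<xi> / 6) = ennreal (1 / (6 * \<nu>))"
        using elim \<open>\<nu> > 0\<close> by (simp add: ennreal_mult[symmetric] field_simps power2_eq_square)
      finally show ?case .
    qed
    also have "\<dots> = ennreal (1 / (6 * \<nu>)) * I t1"
      unfolding h_total[symmetric] by (rule nn_integral_cmult) measurable
    finally show ?thesis .
  qed
  have "I T = 0"
    unfolding I_def
  \<comment> \<open>The constant is the product of 1 / 6 from \<open>y_le\<close> and 1 / (6 \<nu>)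
    from \<open>z_le\<close>.\<close>
  proof (rule quadratic_gronwall[where c="1 / (36 * \<nu>)"])
    show "x s \<le> b s" for s
      unfolding x_def b_def d_def B_def
      by (intro nn_integral_mono) (simp add: ennreal_plus[symmetric] ennreal_leI norm_triangle_ineq4 del: ennreal_plus)
    fix t1 assume t1: "0 \<le> t1" "t1 \<le> T"
    have "(\<integral>\<^sup>+ s. indicator {0..t1} s * (x s)\<^sup>2 \<partial>lborel)
      \<le> (\<integral>\<^sup>+ s. (ennreal (1 / 6) * I t1) * (indicator {0..t1} s * (\<integral>\<^sup>+ \<xi>. norm \<xi> * d s \<xi> \<partial>lborel)) \<partial>lborel)"
    proof (rule nn_integral_mono)
      fix s
      have "(x s)\<^sup>2 \<le> (ennreal (1 / 6) * I t1) * (\<integral>\<^sup>+ \<xi>. norm \<xi> * d s \<xi> \<partial>lborel)" if "0 \<le> s" "s \<le> t1"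
      proof -
        have "(x s)\<^sup>2 \<le> (\<integral>\<^sup>+ \<xi>. inverse (norm \<xi>) * d s \<xi> \<partial>lborel) * (\<integral>\<^sup>+ \<xi>. norm \<xi> * d s \<xi> \<partial>lborel)"
          unfolding x_def by (rule L1_interpolation) measurable
        also have "\<dots> \<le> (ennreal (1 / 6) * I t1) * (\<integral>\<^sup>+ \<xi>. norm \<xi> * d s \<xi> \<partial>lborel)"
          using that t1 by (intro mult_right_mono y_le) auto
        finally show ?thesis .
      qed
      then show "indicator {0..t1} s * (x s)\<^sup>2
        \<le> (ennreal (1 / 6) * I t1) * (indicator {0..t1} s * (\<integral>\<^sup>+ \<xi>. norm \<xi> * d s \<xi> \<partial>lborel))"
        by (auto split: split_indicator)
    qed
    also have "\<dots> = (ennreal (1 / 6) * I t1) * (\<integral>\<^sup>+ s. indicator {0..t1} s * (\<integral>\<^sup>+ \<xi>. norm \<xi> * d s \<xi> \<partial>lborel) \<partial>lborel)"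
      by (rule nn_integral_cmult) measurable
    also have "\<dots> \<le> (ennreal (1 / 6) * I t1) * (ennreal (1 / (6 * \<nu>)) * I t1)"
      by (intro mult_left_mono z_le t1) auto
    also have "\<dots> = (ennreal (1 / 6) * ennreal (1 / (6 * \<nu>))) * (I t1)\<^sup>2"
      by (simp only: power2_eq_square mult_ac)
    also have "ennreal (1 / 6) * ennreal (1 / (6 * \<nu>)) = ennreal (1 / (36 * \<nu>))"
      using \<open>\<nu> > 0\<close> by (subst ennreal_mult[symmetric]) auto
    finally show "(\<integral>\<^sup>+ s. indicator {0..t1} s * (x s)\<^sup>2 \<partial>lborel)
       \<le> ennreal (1 / (36 * \<nu>)) * (\<integral>\<^sup>+ s. indicator {0..t1} s * (x s * b s) \<partial>lborel)\<^sup>2"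
      unfolding I_def .
  qed (use b2 \<open>\<nu> > 0\<close> \<open>T \<ge> 0\<close> in auto)
  with y_le[of T T] \<open>T \<ge> 0\<close> have "(\<integral>\<^sup>+ \<xi>. inverse (norm \<xi>) * d T \<xi> \<partial>lborel) = 0" by simp
  then have "AE \<xi> in lborel. inverse (norm \<xi>) * d T \<xi> = 0"
    by (subst (asm) nn_integral_0_iff_AE) auto
  with AE_lborel_neq0 show ?thesis
    by eventually_elim (auto simp: d_def)
qed

text \<open>The Duhamel integral up to \<open>t\<close> reads the velocity only on [0, t], so values
  at negative times may be altered.\<close>

lemma NSE_mild_cong:
  assumes "\<And>t. t \<ge> 0 \<Longrightarrow> u t = u' t"
  shows "NSE_mild \<nu> u0 u \<longleftrightarrow> NSE_mild \<nu> u0 u'"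
proof -
  have eq: "indicator {0..t} s *\<^sub>R duhamel_integrand \<nu> u t \<xi> s = indicator {0..t} s *\<^sub>R duhamel_integrand \<nu> u' t \<xi> s" for t \<xi> s
    using assms by (auto split: split_indicator simp: duhamel_integrand_def)
  show ?thesis
    unfolding NSE_mild_def set_integrable_def set_lebesgue_integral_def eq using assms by simp
qed

lemma NSE_mild_uniqueness:
  assumes "a > 0" "\<nu> > 0"
    and u: "sol_class a \<sigma> u" "NSE_mild \<nu> u0 u" and v: "sol_class a \<sigma> v" "NSE_mild \<nu> u0 v" and "T \<ge> 0"
  shows "AE \<xi> in lborel. u T \<xi> = v T \<xi>"
proof -
  \<comment> \<open>The class provides joint measurability only after extension by 0 to negative
    times.\<close>
  define cut :: "(real \<Rightarrow> fvec) \<Rightarrow> real \<Rightarrow> fvec" where "cut w t = (if t \<ge> 0 then w t else (\<lambda>_. 0))" for w t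
  have meas: "case_prod (cut w) \<in> borel_measurable (borel \<Otimes>\<^sub>M borel)" if "sol_class a \<sigma> w" for w
  proof -
    have "case_prod (cut w) = (\<lambda>p. if fst p \<ge> 0 then w (fst p) (snd p) else 0)"
      by (auto simp: cut_def)
    moreover have "\<dots> \<in> borel_measurable (borel \<Otimes>\<^sub>M borel)"
      using that by (simp add: sol_class_def lborel_prod borel_prod)
    ultimately show ?thesis by simp
  qed
  have mild: "NSE_mild \<nu> u0 (cut w)" if "NSE_mild \<nu> u0 w" for w
    using that NSE_mild_cong[of "cut w" w \<nu> u0] by (simp add: cut_def)
  \<comment> \<open>The Gevrey weight is at least 1 for a > 0, so the class controls the unweighted
    norms.\<close>
  have weight: "ennreal r \<le> ennreal (exp (a * norm \<xi> powr (1 / \<sigma>))) * ennreal r" for \<xi> :: "real^3" and r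
    using \<open>a > 0\<close> mult_right_mono[of 1 "ennreal (exp (a * norm \<xi> powr (1 / \<sigma>)))" "ennreal r"] by simp
  have int: "(\<integral>\<^sup>+ t. indicator {0..T} t * (\<integral>\<^sup>+ \<xi>. norm \<xi> * ennreal (norm (cut w t \<xi>)) \<partial>lborel) \<partial>lborel) < \<infinity>"
    if "sol_class a \<sigma> w" for w
  proof -
    have "(\<integral>\<^sup>+ t. indicator {0..T} t * (\<integral>\<^sup>+ \<xi>. norm \<xi> * ennreal (norm (cut w t \<xi>)) \<partial>lborel) \<partial>lborel)
      \<le> (\<integral>\<^sup>+ t. indicator {0..} t * Z_norm 1 a \<sigma> (w t) \<partial>lborel)"
      unfolding Z_norm_1_eq
      by (intro nn_integral_mono) (auto split: split_indicator simp: cut_def intro!: nn_integral_mono mult_left_mono weight)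
    with that show ?thesis by (auto simp: sol_class_def intro: le_less_trans)
  qed
  have bdd: "\<exists>M. \<forall>t. 0 \<le> t \<longrightarrow> t \<le> T \<longrightarrow> (\<integral>\<^sup>+ \<xi>. inverse (norm \<xi>) * ennreal (norm (cut w t \<xi>)) \<partial>lborel) \<le> ennreal M"
    if w: "sol_class a \<sigma> w" for w
  proof -
    obtain M where M: "\<And>t. 0 \<le> t \<Longrightarrow> t \<le> T \<Longrightarrow> Z_norm (-1) a \<sigma> (w t) \<le> ennreal M"
      using sol_class_bounded[OF w] by blast
    have "(\<integral>\<^sup>+ \<xi>. inverse (norm \<xi>) * ennreal (norm (cut w t \<xi>)) \<partial>lborel) \<le> Z_norm (-1) a \<sigma> (w t)" if "0 \<le> t" for t
      unfolding Z_norm_minus1_eq using that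
      by (intro nn_integral_mono) (auto simp: cut_def intro!: mult_left_mono weight)
    with M show ?thesis by (meson order_trans)
  qed
  obtain Mu Mv where M: "\<forall>t. 0 \<le> t \<longrightarrow> t \<le> T \<longrightarrow> (\<integral>\<^sup>+ \<xi>. inverse (norm \<xi>) * ennreal (norm (cut u t \<xi>)) \<partial>lborel) \<le> ennreal Mu"
    "\<forall>t. 0 \<le> t \<longrightarrow> t \<le> T \<longrightarrow> (\<integral>\<^sup>+ \<xi>. inverse (norm \<xi>) * ennreal (norm (cut v t \<xi>)) \<partial>lborel) \<le> ennreal Mv"
    using bdd[OF u(1)] bdd[OF v(1)] by blast
  have max: "ennreal Mu \<le> ennreal (max Mu Mv)" "ennreal Mv \<le> ennreal (max Mu Mv)"
    by (auto intro: ennreal_leI)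
  have "AE \<xi> in lborel. cut u T \<xi> = cut v T \<xi>"
    using assms(2) \<open>T \<ge> 0\<close> M max
    by (intro NSE_mild_uniqueness_measurable[where M="max Mu Mv" and \<nu>=\<nu> and ?u0.0=u0] meas mild int u v)
       (auto intro: order_trans)
  then show ?thesis using \<open>T \<ge> 0\<close> by (simp add: cut_def)
qed

text \<open>Velocities are represented by functions of \<xi> rather than by classes modulo null
  sets, hence uniqueness as equality almost everywhere at each time.\<close>

theorem theorem1p4:
  fixes a \<sigma> \<nu> :: real and u0 :: fvec
  assumes "a > 0" and "\<sigma> > 1" and "\<nu> > 0"
    and "in_Z (-1) a \<sigma> u0" and "div_free u0" and "real_field u0"
    and "X_minus1_norm u0 < ennreal \<nu>"
  shows "\<exists>u. sol_class a \<sigma> u \<and> NSE_mild \<nu> u0 u \<and>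
           (\<forall>v. sol_class a \<sigma> v \<and> NSE_mild \<nu> u0 v \<longrightarrow>
                (\<forall>t\<ge>0. AE \<xi> in lborel. v t \<xi> = u t \<xi>))"
proof -
  obtain u where u: "sol_class a \<sigma> u" "NSE_mild \<nu> u0 u"
    using NSE_mild_existence[OF assms] by blast
  moreover have "AE \<xi> in lborel. v t \<xi> = u t \<xi>"
    if "sol_class a \<sigma> v" "NSE_mild \<nu> u0 v" "t \<ge> 0" for v t
    using NSE_mild_uniqueness[OF assms(1,3) that(1,2) u that(3)] .
  ultimately show ?thesis by blast
qed

end
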